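(* Let $\mathcal{H}$ be an infinite-dimensional complex separable Hilbert space and let $T\in B(\mathcal{H})$ satisfy property $(UW_E)$. Let $K\in B(\mathcal{H})$ be a finite rank operator such that $KT=TK$. Then the following are equivalent: (i) $T+K$ is isoloid and satisfies property $(UW_E)$; (ii) $T$ is isoloid and $T+K$ satisfies property $(UW_E)$; (iii) $\sigma_b(T)\cap\sigma_a(T+K)=\sigma_{vv}(T)\cup\bigl[\overline{\sigma_{CI}(T)}\cap\sigma_a(T)\bigr]$.
   Context: $B(\mathcal{H})$ is the algebra of bounded linear operators on $\mathcal{H}$. For $T\in B(\mathcal{H})$, $\mathcal{N}(T)$ is the kernel, $\mathcal{R}(T)$ the range, $\alpha(T)=\dim\mathcal{N}(T)$, $\beta(T)=\operatorname{codim}\mathcal{R}(T)$, $\sigma(T)$ is the spectrum, $\operatorname{iso}\sigma(T)$ the set of its isolated points, and $\sigma_a(T)$ the approximate point spectrum (the set of $\lambda$ such that $T-\lambda I$ is not bounded below). $T$ is upper (resp. lower) semi-Fredholm if $\mathcal{R}(T)$ is closed and $\alpha(T)<\infty$ (resp. $\beta(T)<\infty$), and semi-Fredholm if it is either; its index is $i(T)=\alpha(T)-\beta(T)$. $T$ is Fredholm if it is both. $T$ is upper semi-Weyl if it is semi-Fredholm with $i(T)\le 0$. The upper semi-Weyl spectrum is $\sigma_{uw}(T)=\{\lambda\in\mathbb{C}: T-\lambda I\text{ is not upper semi-Weyl}\}$. $T$ is Browder if it is Fredholm with finite ascent and finite descent; the Browder spectrum is $\sigma_b(T)=\{\lambda\in\mathbb{C}: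 T-\lambda I\text{ is not Browder}\}$. $E(T)=\{\lambda\in\operatorname{iso}\sigma(T):\alpha(T-\lambda I)>0\}$. $T$ satisfies property $(UW_E)$ if $\sigma_a(T)\setminus E(T)=\sigma_{uw}(T)$, i.e. $\sigma_a(T)\setminus\sigma_{uw}(T)=E(T)$. $T$ is isoloid if every isolated point of $\sigma(T)$ is an eigenvalue of $T$. $T$ is consistently invertible if for each $S\in B(\mathcal{H})$, $TS$ and $ST$ are either both invertible or both non-invertible; $\sigma_{CI}(T)=\{\lambda\in\mathbb{C}: T-\lambda I\text{ is not consistently invertible}\}$, and $\overline{\sigma_{CI}(T)}$ is its closure. $\sigma_{vv}(T)=\mathbb{C}\setminus\rho_{vv}(T)$, where $\rho_{vv}(T)$ is the set of $\lambda\in\mathbb{C}$ for which there exists $\epsilon>0$ such that, for every $\mu$ with $0<|\lambda-\mu|<\epsilon$, $T-\mu I$ is upper semi-Weyl and $\mathcal{N}(T-\mu I)\subseteq\bigcap_{n=1}^{\infty}\mathcal{R}((T-\mu I)^n)$. *)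

theory Defs
  imports "HOL-Analysis.Analysis"
begin

class scaleC =
  fixes scaleC :: "complex \<Rightarrow> 'a \<Rightarrow> 'a" (infixr \<open>*\<^sub>C\<close> 75)

text \<open>The library has only real Hilbert spaces, so the complex structure is added to one.
  The complex inner product is linear in its first argument.  Its real part is the real inner
  product, which ties the norm (and hence topology and completeness) to it:
  \<open>\<parallel>x\<parallel>\<^sup>2 = inner x x = Re (cinner x x)\<close>.\<close>

class complex_hilbert_space = real_inner + banach + scaleC +
  fixes cinner :: "'a \<Rightarrow> 'a \<Rightarrow> complex"
  assumes scaleC_add_right: "a *\<^sub>C (x + y) = a *\<^sub>C x + a *\<^sub>C y"
    and scaleC_add_left: "(a + b) *\<^sub>C x = a *\<^sub>C x + b *\<^sub>C x"
    and scaleC_scaleC: "a *\<^sub>C (b *\<^sub>C x) = (a * b) *\<^sub>C x"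
    and scaleC_of_real: "complex_of_real r *\<^sub>C x = r *\<^sub>R x"
    and cinner_commute: "cinner x y = cnj (cinner y x)"
    and cinner_add_left: "cinner (x + y) z = cinner x z + cinner y z"
    and cinner_scaleC_left: "cinner (a *\<^sub>C x) y = a * cinner x y"
    and inner_eq_Re_cinner: "inner x y = Re (cinner x y)"

global_interpretation cvec: vector_space "scaleC :: complex \<Rightarrow> 'a \<Rightarrow> 'a :: complex_hilbert_space"
proof
  show "1 *\<^sub>C x = x" for x :: 'a
    using scaleC_of_real[of 1 x] by simp
qed (simp_all add: scaleC_add_right scaleC_add_left scaleC_scaleC)

text \<open>All infinite dimensions are identified with \<open>\<infinity>\<close>.\<close>

definition cdim :: "'a::complex_hilbert_space set \<Rightarrow> enat" where
  "cdim S = (if \<exists>B. finite B \<and> S \<subseteq> cvec.span B then enat (cvec.dim S) else \<infinity>)"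

text \<open>The dimension of the quotient space by a subspace \<open>S\<close>: the least number of vectors whose
  cosets modulo \<open>S\<close> span the quotient.\<close>

definition ccodim :: "'a::complex_hilbert_space set \<Rightarrow> enat" where
  "ccodim S = Inf {enat (card B) | B. finite B \<and> cvec.span (S \<union> B) = UNIV}"

lemma ccodim_eq_cdim_complement:
  fixes S C :: "'a::complex_hilbert_space set"
  assumes S: "cvec.subspace S" and C: "cvec.subspace C"
    and int: "S \<inter> C = {0}" and sum: "\<And>x. \<exists>s\<in>S. \<exists>c\<in>C. x = s + c"
  shows "ccodim S = cdim C"
proof (rule antisym)
  show "ccodim S \<le> cdim C"
  proof (cases "\<exists>B. finite B \<and> C \<subseteq> cvec.span B")
    case True
    then obtain D where D: "finite D" "C \<subseteq> cvec.span D" by blast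
    obtain B where B: "B \<subseteq> C" "cvec.independent B" "C \<subseteq> cvec.span B" "card B = cvec.dim C"
      using cvec.basis_exists by blast
    have fin: "finite B"
      using cvec.independent_span_bound[OF D(1) B(2)] B(1) D(2) by blast
    have "x \<in> cvec.span (S \<union> B)" for x
    proof -
      obtain s c where "s \<in> S" "c \<in> C" "x = s + c" using sum by blast
      moreover have "s \<in> cvec.span (S \<union> B)" using \<open>s \<in> S\<close> by (simp add: cvec.span_base)
      moreover have "c \<in> cvec.span (S \<union> B)"
        using \<open>c \<in> C\<close> B(3) cvec.span_mono[of B "S \<union> B"] by blast
      ultimately show ?thesis by (simp add: cvec.span_add)
    qed
    then have "cvec.span (S \<union> B) = UNIV" by blast
    then have "ccodim S \<le> enat (card B)"
      unfolding ccodim_def using fin by (intro Inf_lower) blast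
    then show ?thesis using True B(4) by (simp add: cdim_def)
  next
    case False
    then have "cdim C = \<infinity>" unfolding cdim_def by (rule if_not_P)
    then show ?thesis by simp
  qed
  show "cdim C \<le> ccodim S"
    unfolding ccodim_def
  proof (rule Inf_greatest, safe)
    fix B :: "'a set" assume fin: "finite B" and spn: "cvec.span (S \<union> B) = UNIV"
    have "\<forall>x. \<exists>c. c \<in> C \<and> x - c \<in> S"
    proof
      fix x obtain s c where "s \<in> S" "c \<in> C" "x = s + c" using sum by blast
      then show "\<exists>c. c \<in> C \<and> x - c \<in> S" by (intro exI[of _ c]) simp
    qed
    then obtain p where p: "\<And>x. p x \<in> C" "\<And>x. x - p x \<in> S" by metis
    have "C \<subseteq> cvec.span (p ` B)"
    proof
      fix c assume "c \<in> C"
      have "c \<in> cvec.span (S \<union> B)" using spn by simp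
      then obtain s b where sb: "c = s + b" "s \<in> cvec.span S" "b \<in> cvec.span B"
        by (auto simp: cvec.span_Un)
      then have sS: "s \<in> S" using cvec.span_eq_iff S by blast
      have "\<exists>d\<in>cvec.span (p ` B). b - d \<in> S"
        using sb(3)
      proof (induction rule: cvec.span_induct_alt)
        case base
        then show ?case using cvec.span_zero cvec.subspace_0[OF S] by force
      next
        case (step k x y)
        then obtain d where d: "d \<in> cvec.span (p ` B)" "y - d \<in> S" by blast
        have "k *\<^sub>C p x + d \<in> cvec.span (p ` B)"
          using d step(1) by (simp add: cvec.span_add cvec.span_scale cvec.span_base)
        moreover have "k *\<^sub>C (x - p x) + (y - d) \<in> S"
          using S p(2) d(2) cvec.subspace_add cvec.subspace_scale by blast
        then have "k *\<^sub>C x + y - (k *\<^sub>C p x + d) \<in> S"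
          by (simp add: cvec.scale_right_diff_distrib algebra_simps)
        ultimately show ?case by blast
      qed
      then obtain d where d: "d \<in> cvec.span (p ` B)" "b - d \<in> S" by blast
      have "d \<in> C" using d(1) p(1) cvec.span_minimal[OF _ C, of "p ` B"] by blast
      then have "c - d \<in> C" using C \<open>c \<in> C\<close> cvec.subspace_diff by blast
      moreover have "c - d = s + (b - d)" using sb by simp
      then have "c - d \<in> S" using cvec.subspace_add[OF S sS d(2)] by (simp only:)
      ultimately have "c - d = 0" using int by blast
      then show "c \<in> cvec.span (p ` B)" using d(1) by simp
    qed
    moreover from this have "cvec.dim C \<le> card (p ` B)"
      using fin by (intro cvec.dim_le_card) auto
    ultimately show "cdim C \<le> enat (card B)"
      using fin card_image_le[OF fin, of p] unfolding cdim_def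
      by (auto intro: order_trans)
  qed
qed

definition bounded_clinear :: "('a::complex_hilbert_space \<Rightarrow> 'a) \<Rightarrow> bool" where
  "bounded_clinear T \<longleftrightarrow> bounded_linear T \<and> (\<forall>a x. T (a *\<^sub>C x) = a *\<^sub>C T x)"

definition ker :: "('a::complex_hilbert_space \<Rightarrow> 'a) \<Rightarrow> 'a set" where
  "ker T = {x. T x = 0}"

definition nullity :: "('a::complex_hilbert_space \<Rightarrow> 'a) \<Rightarrow> enat" where
  "nullity T = cdim (ker T)"

definition defect :: "('a::complex_hilbert_space \<Rightarrow> 'a) \<Rightarrow> enat" where
  "defect T = ccodim (range T)"

definition finite_rank :: "('a::complex_hilbert_space \<Rightarrow> 'a) \<Rightarrow> bool" where
  "finite_rank T \<longleftrightarrow> cdim (range T) < \<infinity>"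

definition op_shift :: "('a::complex_hilbert_space \<Rightarrow> 'a) \<Rightarrow> complex \<Rightarrow> 'a \<Rightarrow> 'a" where
  "op_shift T \<mu> = (\<lambda>x. T x - \<mu> *\<^sub>C x)"

definition op_invertible :: "('a::complex_hilbert_space \<Rightarrow> 'a) \<Rightarrow> bool" where
  "op_invertible T \<longleftrightarrow> (\<exists>S. bounded_clinear S \<and> S \<circ> T = id \<and> T \<circ> S = id)"

definition bounded_below_op :: "('a::complex_hilbert_space \<Rightarrow> 'a) \<Rightarrow> bool" where
  "bounded_below_op T \<longleftrightarrow> (\<exists>c>0. \<forall>x. c * norm x \<le> norm (T x))"

definition spectrum :: "('a::complex_hilbert_space \<Rightarrow> 'a) \<Rightarrow> complex set" where
  "spectrum T = {\<mu>. \<not> op_invertible (op_shift T \<mu>)}"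

definition approx_spectrum :: "('a::complex_hilbert_space \<Rightarrow> 'a) \<Rightarrow> complex set" where
  "approx_spectrum T = {\<mu>. \<not> bounded_below_op (op_shift T \<mu>)}"

definition iso_spectrum :: "('a::complex_hilbert_space \<Rightarrow> 'a) \<Rightarrow> complex set" where
  "iso_spectrum T = {\<mu>. \<mu> isolated_in (spectrum T)}"

definition is_eigenvalue :: "('a::complex_hilbert_space \<Rightarrow> 'a) \<Rightarrow> complex \<Rightarrow> bool" where
  "is_eigenvalue T \<mu> \<longleftrightarrow> (\<exists>x. x \<noteq> 0 \<and> T x = \<mu> *\<^sub>C x)"

definition isoloid :: "('a::complex_hilbert_space \<Rightarrow> 'a) \<Rightarrow> bool" where
  "isoloid T \<longleftrightarrow> (\<forall>\<mu>\<in>iso_spectrum T. is_eigenvalue T \<mu>)"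

definition upper_semi_fredholm :: "('a::complex_hilbert_space \<Rightarrow> 'a) \<Rightarrow> bool" where
  "upper_semi_fredholm T \<longleftrightarrow> closed (range T) \<and> nullity T < \<infinity>"

definition lower_semi_fredholm :: "('a::complex_hilbert_space \<Rightarrow> 'a) \<Rightarrow> bool" where
  "lower_semi_fredholm T \<longleftrightarrow> closed (range T) \<and> defect T < \<infinity>"

definition semi_fredholm :: "('a::complex_hilbert_space \<Rightarrow> 'a) \<Rightarrow> bool" where
  "semi_fredholm T \<longleftrightarrow> upper_semi_fredholm T \<or> lower_semi_fredholm T"

definition fredholm :: "('a::complex_hilbert_space \<Rightarrow> 'a) \<Rightarrow> bool" where
  "fredholm T \<longleftrightarrow> upper_semi_fredholm T \<and> lower_semi_fredholm T"

text \<open>Meaningful only for semi-Fredholm \<open>T\<close>, where at most one of the two terms is infinite.\<close>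

definition fredholm_index :: "('a::complex_hilbert_space \<Rightarrow> 'a) \<Rightarrow> ereal" where
  "fredholm_index T = ereal_of_enat (nullity T) - ereal_of_enat (defect T)"

definition upper_semi_weyl :: "('a::complex_hilbert_space \<Rightarrow> 'a) \<Rightarrow> bool" where
  "upper_semi_weyl T \<longleftrightarrow> semi_fredholm T \<and> fredholm_index T \<le> 0"

definition upper_semi_weyl_spectrum :: "('a::complex_hilbert_space \<Rightarrow> 'a) \<Rightarrow> complex set" where
  "upper_semi_weyl_spectrum T = {\<mu>. \<not> upper_semi_weyl (op_shift T \<mu>)}"

text \<open>Here \<open>Inf {} = \<infinity>\<close>.\<close>

definition ascent :: "('a::complex_hilbert_space \<Rightarrow> 'a) \<Rightarrow> enat" where
  "ascent T = Inf {enat n | n. ker (T ^^ n) = ker (T ^^ Suc n)}"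

definition descent :: "('a::complex_hilbert_space \<Rightarrow> 'a) \<Rightarrow> enat" where
  "descent T = Inf {enat n | n. range (T ^^ n) = range (T ^^ Suc n)}"

definition browder :: "('a::complex_hilbert_space \<Rightarrow> 'a) \<Rightarrow> bool" where
  "browder T \<longleftrightarrow> fredholm T \<and> ascent T < \<infinity> \<and> descent T < \<infinity>"

definition browder_spectrum :: "('a::complex_hilbert_space \<Rightarrow> 'a) \<Rightarrow> complex set" where
  "browder_spectrum T = {\<mu>. \<not> browder (op_shift T \<mu>)}"

definition iso_eigenvalues :: "('a::complex_hilbert_space \<Rightarrow> 'a) \<Rightarrow> complex set" where
  "iso_eigenvalues T = {\<mu> \<in> iso_spectrum T. nullity (op_shift T \<mu>) > 0}"

definition property_UWE :: "('a::complex_hilbert_space \<Rightarrow> 'a) \<Rightarrow> bool" where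
  "property_UWE T \<longleftrightarrow> approx_spectrum T - iso_eigenvalues T = upper_semi_weyl_spectrum T"

definition consistently_invertible :: "('a::complex_hilbert_space \<Rightarrow> 'a) \<Rightarrow> bool" where
  "consistently_invertible T \<longleftrightarrow>
     (\<forall>S. bounded_clinear S \<longrightarrow> (op_invertible (T \<circ> S) \<longleftrightarrow> op_invertible (S \<circ> T)))"

definition CI_spectrum :: "('a::complex_hilbert_space \<Rightarrow> 'a) \<Rightarrow> complex set" where
  "CI_spectrum T = {\<mu>. \<not> consistently_invertible (op_shift T \<mu>)}"

definition vv_resolvent :: "('a::complex_hilbert_space \<Rightarrow> 'a) \<Rightarrow> complex set" where
  "vv_resolvent T = {l. \<exists>\<epsilon>>0. \<forall>\<mu>. 0 < cmod (l - \<mu>) \<and> cmod (l - \<mu>) < \<epsilon> \<longrightarrow>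
     upper_semi_weyl (op_shift T \<mu>) \<and>
     ker (op_shift T \<mu>) \<subseteq> (\<Inter>n\<in>{1..}. range (op_shift T \<mu> ^^ n))}"

definition vv_spectrum :: "('a::complex_hilbert_space \<Rightarrow> 'a) \<Rightarrow> complex set" where
  "vv_spectrum T = UNIV - vv_resolvent T"

end

theory Submission
  imports Defs
begin

text \<open>An operator is upper semi-Weyl iff some finite rank perturbation of it is bounded below, so this
  class is stable under finite rank perturbations. If \<open>T\<close> and \<open>K\<close> commute and \<open>T + K - \<mu>\<close> is invertible,
  then every eigenvector of \<open>T\<close> for \<open>\<mu>\<close> lies in the range of \<open>K\<close>; hence \<open>T\<close> and \<open>T + K\<close> have the same
  points with a punctured neighbourhood in the resolvent set. At such a point \<open>\<lambda>\<close>, if \<open>T - \<lambda>\<close> is upper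
  semi-Weyl, then it is Browder: a nonzero vector of the kernel in all ranges \<open>R((T - \<lambda>)\<^sup>n)\<close> would
  propagate to eigenvectors for all nearby \<open>\<mu>\<close>. On a Hilbert space \<open>T\<close> fails to be consistently invertible
  exactly when it is surjective but not injective or bounded below but not surjective, so a bounded
  below operator is invertible iff it is consistently invertible. The equivalences follow from these
  facts and from \<open>(UW\<^sub>E)\<close> by propositional reasoning at each \<open>\<lambda>\<close>.\<close>

section \<open>Open mappings and orthogonal projections\<close>

text \<open>The usual route passes through additivity and local constancy of the index and the
  punctured neighbourhood theorem. Both are bypassed: once an upper semi-Weyl operator is written as
  a bounded below operator plus one of finite rank, perturbation is mere addition of finite rank
  terms; near an isolated point of the spectrum the bounded below summand is a limit of invertible
  operators and hence invertible. The equality (iii) is best read on complements. A point is missing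
  on the left iff \<open>T - \<lambda>\<close> is Browder or \<open>T + K - \<lambda>\<close> is
  bounded below. It is missing on the right iff it lies in the vv-resolvent and, moreover, either
  lies off the closure of the CI spectrum or has \<open>T - \<lambda>\<close> bounded below.
  Property \<open>(UW_E)\<close> of \<open>T\<close> turns the vv-resolvent into the set of points
  around which \<open>T - \<mu>\<close> is bounded below; off the closure of the CI spectrum this
  improves to invertible. The isoloid property makes such points Browder, and \<open>(UW_E)\<close>
  for \<open>T + K\<close> handles the points where \<open>T - \<lambda>\<close> is bounded below
  but \<open>T + K - \<lambda>\<close> is not.\<close>

lemma exact_solution_from_approximate:
  fixes L :: "'a::banach \<Rightarrow> 'b::real_normed_vector"
  assumes L: "bounded_linear L" and M: "closed M" "subspace M" and Y: "subspace Y"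
    and LM: "L ` M \<subseteq> Y" and K: "K \<ge> 0"
    and approx: "\<And>y. y \<in> Y \<Longrightarrow> \<exists>x\<in>M. norm x \<le> K * norm y \<and> norm (y - L x) \<le> norm y / 2"
    and y: "y \<in> Y"
  shows "\<exists>x\<in>M. L x = y \<and> norm x \<le> 2 * K * norm y"
proof -
  interpret L: bounded_linear L by fact
  obtain g where g: "\<And>y. y \<in> Y \<Longrightarrow> g y \<in> M" "\<And>y. y \<in> Y \<Longrightarrow> norm (g y) \<le> K * norm y"
    "\<And>y. y \<in> Y \<Longrightarrow> norm (y - L (g y)) \<le> norm y / 2"
    using approx by metis
  \<comment> \<open>\<open>r k\<close> is the residual after \<open>k\<close> corrections. It halves
    each time, so the corrections are dominated by a geometric series with sum
    \<open>2 * K * norm y\<close>.\<close>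
  define r where "r k = ((\<lambda>y. y - L (g y)) ^^ k) y" for k
  have r0: "r 0 = y" and rS: "r (Suc k) = r k - L (g (r k))" for k by (simp_all add: r_def)
  have rY: "r k \<in> Y" for k
  proof (induction k)
    case (Suc k)
    then have "L (g (r k)) \<in> Y" using g(1) LM by blast
    then show ?case using Suc rS subspace_diff[OF Y] by simp
  qed (simp add: r0 y)
  have rn: "norm (r k) \<le> norm y * (1/2) ^ k" for k
  proof (induction k)
    case (Suc k)
    have "norm (r (Suc k)) \<le> norm (r k) / 2" using g(3)[OF rY] rS by simp
    then show ?case using Suc by simp
  qed (simp add: r0)
  define x where "x k = g (r k)" for k
  have xn: "norm (x k) \<le> K * norm y * (1/2) ^ k" for k
    using g(2)[OF rY[of k]] mult_left_mono[OF rn[of k] K] by (simp add: x_def mult.assoc)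
  have sums: "(\<lambda>k. K * norm y * (1/2::real) ^ k) sums (2 * K * norm y)"
    using sums_mult[OF geometric_sums[of "1/2::real"], of "K * norm y"] by (simp add: ac_simps)
  have sn: "summable (\<lambda>k. norm (x k))"
    by (rule summable_comparison_test'[OF sums_summable[OF sums], of 0]) (use xn in auto)
  have sx: "summable x" using summable_norm_cancel[OF sn] .
  have partial: "L (\<Sum>k<n. x k) = y - r n" for n
    by (induction n) (simp_all add: r0 rS L.zero L.add x_def)
  have lim: "(\<lambda>n. \<Sum>k<n. x k) \<longlonglongrightarrow> suminf x"
    using sx summable_LIMSEQ by blast
  have "r \<longlonglongrightarrow> 0"
  proof (rule Lim_null_comparison)
    show "\<forall>\<^sub>F n in sequentially. norm (r n) \<le> norm y * (1/2) ^ n" using rn by simp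
    show "(\<lambda>n. norm y * (1 / 2) ^ n) \<longlonglongrightarrow> 0"
      by (intro tendsto_mult_right_zero LIMSEQ_realpow_zero) auto
  qed
  then have "(\<lambda>n. y - r n) \<longlonglongrightarrow> y - 0" by (intro tendsto_intros)
  then have "(\<lambda>n. L (\<Sum>k<n. x k)) \<longlonglongrightarrow> y" by (simp add: partial)
  moreover have "(\<lambda>n. L (\<Sum>k<n. x k)) \<longlonglongrightarrow> L (suminf x)" by (rule L.tendsto[OF lim])
  ultimately have "L (suminf x) = y" using LIMSEQ_unique by blast
  moreover have "suminf x \<in> M"
    using lim closed_sequentially[OF M(1)] subspace_sum[OF M(2)] g(1) rY x_def by metis
  moreover have "norm (suminf x) \<le> 2 * K * norm y"
    using summable_norm[OF sn] suminf_le[OF xn sn sums_summable[OF sums]] sums_unique[OF sums]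
    by linarith
  ultimately show ?thesis by blast
qed

text \<open>Baire's theorem is applied to the image of \<open>M\<close> in its relative topology,
  complete because the image is closed. It gives a relative ball inside the closure of the image of
  a bounded part of \<open>M\<close>; this yields approximate solutions, which the previous lemma
  makes exact.\<close>

theorem open_mapping_subspace:
  fixes A :: "'a::banach \<Rightarrow> 'b::banach"
  assumes A: "bounded_linear A" and M: "closed M" "subspace M" and R: "closed (A ` M)"
  shows "\<exists>C>0. \<forall>y\<in>A ` M. \<exists>x\<in>M. A x = y \<and> norm x \<le> C * norm y"
proof -
  interpret A: bounded_linear A by fact
  define Y where "Y = A ` M"
  have Y: "subspace Y" unfolding Y_def using M(2) A.linear_axioms linear_subspace_image by blast
  define G where "G n = closure (A ` (M \<inter> cball 0 (real n)))" for n
  have GY: "G n \<subseteq> Y" for n unfolding G_def Y_def by (rule closure_minimal[OF _ R]) auto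
  have un: "(\<Union>n. G n) = Y"
  proof
    show "Y \<subseteq> (\<Union>n. G n)"
    proof
      fix y assume "y \<in> Y"
      then obtain x where x: "x \<in> M" "y = A x" by (auto simp: Y_def)
      obtain n where "norm x \<le> real n" using real_arch_simple by blast
      then have "y \<in> A ` (M \<inter> cball 0 (real n))" using x by auto
      then have "y \<in> G n" unfolding G_def by (rule subsetD[OF closure_subset])
      then show "y \<in> (\<Union>n. G n)" by (rule UN_I[OF UNIV_I])
    qed
  qed (use GY in blast)
  have "\<exists>n. (top_of_set Y) interior_of (G n) \<noteq> {}"
  proof (rule ccontr)
    assume "\<not> ?thesis"
    then have int: "\<And>n. (top_of_set Y) interior_of (G n) = {}" by blast
    have "closedin (top_of_set Y) (G n)" for n
      using GY by (intro closed_subset) (simp_all add: G_def)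
    moreover have "completely_metrizable_space (top_of_set Y)"
      using R completely_metrizable_space_closedin[OF completely_metrizable_space_euclidean, of Y]
      unfolding Y_def by (simp only: closed_closedin)
    ultimately have "(top_of_set Y) interior_of \<Union>(range G) = {}"
      using int by (intro Baire_category_alt disjI1) auto
    then have "Y = {}" by (metis un interior_of_topspace topspace_euclidean_subtopology)
    then show False using subspace_0[OF Y] by blast
  qed
  then obtain n y0 where "y0 \<in> (top_of_set Y) interior_of (G n)" by blast
  then obtain U where U: "openin (top_of_set Y) U" "y0 \<in> U" "U \<subseteq> G n"
    by (auto simp: interior_of_def)
  then obtain r where r: "r > 0" "\<And>z. z \<in> Y \<Longrightarrow> dist z y0 < r \<Longrightarrow> z \<in> G n" "y0 \<in> Y"
    unfolding openin_euclidean_subtopology_iff by blast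
  \<comment> \<open>A vector \<open>y\<close> is scaled to length \<open>r / 2\<close>. The
    approximate preimages of \<open>y0 + s y\<close> and \<open>y0\<close> differ by at most
    \<open>2 n\<close>, and scaling back by \<open>1 / s = 2 norm y / r\<close> gives the factor
    \<open>4 n / r\<close>.\<close>
  define K where "K = 4 * real n / r"
  have K: "K \<ge> 0" using r(1) by (simp add: K_def)
  have "\<exists>x\<in>M. norm x \<le> K * norm y \<and> norm (y - A x) \<le> norm y / 2" if y: "y \<in> Y" for y
  proof (cases "y = 0")
    case True
    then show ?thesis using subspace_0[OF M(2)] by (auto intro!: bexI[of _ 0] simp: A.zero)
  next
    case False
    define s where "s = r / (2 * norm y)"
    have s: "s > 0" using False r(1) by (simp add: s_def)
    have "s *\<^sub>R y \<in> Y" using y Y subspace_scale by blast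
    then have "y0 + s *\<^sub>R y \<in> Y" using r(3) Y subspace_add by blast
    moreover have "dist (y0 + s *\<^sub>R y) y0 < r" using r(1) False by (simp add: dist_norm s_def)
    ultimately have m1: "y0 + s *\<^sub>R y \<in> G n" by (rule r(2))
    have m2: "y0 \<in> G n" using r by simp
    \<comment> \<open>Two errors of size \<open>e\<close> add up to half of
      \<open>s * norm y\<close>, the halving required by the iteration.\<close>
    define e where "e = s * norm y / 4"
    have e: "e > 0" using s False by (simp add: e_def)
    obtain x1 where x1: "x1 \<in> M" "norm x1 \<le> n" "dist (A x1) (y0 + s *\<^sub>R y) < e"
      using m1 e unfolding G_def closure_approachable by fastforce
    obtain x2 where x2: "x2 \<in> M" "norm x2 \<le> n" "dist (A x2) y0 < e"
      using m2 e unfolding G_def closure_approachable by fastforce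
    define x where "x = (1/s) *\<^sub>R (x1 - x2)"
    have "x \<in> M" unfolding x_def using x1 x2 M(2) subspace_scale subspace_diff by blast
    moreover have "norm x \<le> K * norm y"
    proof -
      have "norm (x1 - x2) \<le> 2 * n" using norm_triangle_ineq4[of x1 x2] x1 x2 by linarith
      then have "norm x \<le> (1/s) * (2 * n)" unfolding x_def using s by (simp add: divide_right_mono)
      also have "\<dots> = K * norm y" using False by (simp add: s_def K_def field_simps)
      finally show ?thesis .
    qed
    moreover have "norm (y - A x) \<le> norm y / 2"
    proof -
      have "s *\<^sub>R (y - A x) = ((y0 + s *\<^sub>R y) - A x1) - (y0 - A x2)"
        using s unfolding x_def by (simp add: algebra_simps A.scaleR A.diff)
      then have "norm (s *\<^sub>R (y - A x)) \<le> norm ((y0 + s *\<^sub>R y) - A x1) + norm (y0 - A x2)"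
        using norm_triangle_ineq4[of "(y0 + s *\<^sub>R y) - A x1" "y0 - A x2"] by simp
      also have "\<dots> \<le> e + e" using x1(3) x2(3) by (simp add: dist_norm norm_minus_commute)
      finally have "s * norm (y - A x) \<le> s * (norm y / 2)" using s by (simp add: e_def)
      then show ?thesis using s by (simp only: mult_le_cancel_left_pos)
    qed
    ultimately show ?thesis by blast
  qed
  then have "\<forall>y\<in>Y. \<exists>x\<in>M. A x = y \<and> norm x \<le> 2 * K * norm y"
    using exact_solution_from_approximate[OF A M Y _ K] unfolding Y_def by blast
  \<comment> \<open>The added 1 makes the constant positive, since \<open>K = 0\<close> when
    \<open>n = 0\<close>.\<close>
  moreover have "2 * K * norm (y::'b) \<le> (2 * K + 1) * norm y" for y by (simp add: algebra_simps)
  ultimately have "\<forall>y\<in>Y. \<exists>x\<in>M. A x = y \<and> norm x \<le> (2 * K + 1) * norm y"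
    by (meson order_trans)
  then show ?thesis using K unfolding Y_def by (intro exI[of _ "2*K+1"]) auto
qed

lemma orthogonal_projection_exists:
  fixes M :: "'a::{real_inner, banach} set"
  assumes M: "closed M" "subspace M"
  shows "\<exists>m\<in>M. \<forall>z\<in>M. inner (x - m) z = 0"
proof -
  define d where "d = infdist x M"
  have ne: "M \<noteq> {}" using subspace_0[OF M(2)] by blast
  have dle: "d \<le> norm (x - m)" if "m \<in> M" for m
    using infdist_le[OF that, of x] by (simp add: d_def dist_norm)
  have d0: "d \<ge> 0" by (simp add: d_def infdist_nonneg)
  have "\<exists>m\<in>M. norm (x - m) < d + 1 / Suc n" for n
    using cINF_less_iff[OF ne bdd_below_image_dist, of x "d + 1 / Suc n"]
    by (simp add: d_def infdist_notempty[OF ne] dist_norm)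
  then obtain m where m: "\<And>n. m n \<in> M" "\<And>n. norm (x - m n) < d + 1 / Suc n" by metis
  \<comment> \<open>Parallelogram law for \<open>x - m i\<close> and \<open>x - m j\<close>; the
    midpoint of \<open>m i\<close> and \<open>m j\<close> is in \<open>M\<close>, so at distance at
    least \<open>d\<close> from \<open>x\<close>. This makes the minimising sequence Cauchy.\<close>
  have bound: "(norm (m i - m j))\<^sup>2 \<le> 2 * (norm (x - m i))\<^sup>2 + 2 * (norm (x - m j))\<^sup>2 - 4 * d\<^sup>2" for i j
  proof -
    have "(1/2) *\<^sub>R (m i + m j) \<in> M" using m M(2) subspace_scale subspace_add by blast
    then have "d\<^sup>2 \<le> (norm (x - (1/2) *\<^sub>R (m i + m j)))\<^sup>2" using dle d0 by (simp add: power_mono)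
    moreover have "(norm (m i - m j))\<^sup>2 + 4 * (norm (x - (1/2) *\<^sub>R (m i + m j)))\<^sup>2
        = 2 * (norm (x - m i))\<^sup>2 + 2 * (norm (x - m j))\<^sup>2"
      by (simp add: power2_norm_eq_inner inner_diff inner_add inner_commute algebra_simps)
    ultimately show ?thesis by linarith
  qed
  have lim: "(\<lambda>n. norm (x - m n)) \<longlonglongrightarrow> d"
  proof (rule tendsto_sandwich[of "\<lambda>_. d" _ _ "\<lambda>n. d + 1 / Suc n"])
    show "(\<lambda>n. d + 1 / Suc n) \<longlonglongrightarrow> d"
      using tendsto_add[OF tendsto_const[of d] LIMSEQ_inverse_real_of_nat] by (simp add: inverse_eq_divide)
  qed (use m(1) dle less_imp_le[OF m(2)] in \<open>auto intro!: always_eventually\<close>)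
  have "Cauchy m"
  proof (rule metric_CauchyI)
    fix e :: real assume e: "e > 0"
    have "(\<lambda>n. (norm (x - m n))\<^sup>2) \<longlonglongrightarrow> d\<^sup>2" using lim by (intro tendsto_intros)
    moreover have "d\<^sup>2 < d\<^sup>2 + e\<^sup>2 / 4" using e by simp
    ultimately have "\<forall>\<^sub>F n in sequentially. (norm (x - m n))\<^sup>2 < d\<^sup>2 + e\<^sup>2/4"
      by (rule order_tendstoD)
    then obtain N where N: "\<And>n. n \<ge> N \<Longrightarrow> (norm (x - m n))\<^sup>2 < d\<^sup>2 + e\<^sup>2/4"
      by (auto simp: eventually_sequentially)
    show "\<exists>N. \<forall>i\<ge>N. \<forall>j\<ge>N. dist (m i) (m j) < e"
    proof (intro exI allI impI)
      fix i j assume "i \<ge> N" "j \<ge> N"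
      then have "(norm (m i - m j))\<^sup>2 < e\<^sup>2" using bound[of i j] N[of i] N[of j] by linarith
      then show "dist (m i) (m j) < e" using e by (simp add: dist_norm power_less_imp_less_base)
    qed
  qed
  then obtain p where p: "m \<longlonglongrightarrow> p" using Cauchy_convergent_iff convergent_def by blast
  have pM: "p \<in> M" using closed_sequentially[OF M(1)] m(1) p by blast
  have "(\<lambda>n. norm (x - m n)) \<longlonglongrightarrow> norm (x - p)" using p by (intro tendsto_intros)
  then have pd: "norm (x - p) = d" using lim LIMSEQ_unique by blast
  have "inner (x - p) z = 0" if z: "z \<in> M" for z
  proof (cases "z = 0")
    case False
    \<comment> \<open>The value minimising the norm of \<open>x - p - t z\<close>; a nonzero inner
      product would bring \<open>x\<close> closer to \<open>M\<close> than \<open>d\<close>.\<close>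
    define t where "t = inner (x - p) z / inner z z"
    have "p + t *\<^sub>R z \<in> M" using pM z M(2) subspace_scale subspace_add by blast
    then have "(norm (x - p))\<^sup>2 \<le> (norm (x - (p + t *\<^sub>R z)))\<^sup>2" using dle pd d0 by (simp add: power_mono)
    also have "\<dots> = (norm (x - p))\<^sup>2 - 2 * t * inner (x - p) z + t * t * inner z z"
      by (simp add: power2_norm_eq_inner inner_diff inner_add inner_commute algebra_simps)
    also have "\<dots> = (norm (x - p))\<^sup>2 - (inner (x - p) z)\<^sup>2 / inner z z"
      using False by (simp add: t_def power2_eq_square field_simps)
    finally have "(inner (x - p) z)\<^sup>2 / inner z z \<le> 0" by simp
    moreover have "inner z z > 0" using False by simp
    ultimately show ?thesis by (simp add: divide_le_0_iff)
  qed simp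
  then show ?thesis using pM by blast
qed

section \<open>Bounded complex-linear operators\<close>

global_interpretation cvec_pair: vector_space_pair
  "scaleC :: complex \<Rightarrow> 'a \<Rightarrow> 'a::complex_hilbert_space" "scaleC :: complex \<Rightarrow> 'b \<Rightarrow> 'b::complex_hilbert_space"
  by unfold_locales

abbreviation clinear :: "('a::complex_hilbert_space \<Rightarrow> 'a) \<Rightarrow> bool" where
  "clinear \<equiv> Vector_Spaces.linear scaleC scaleC"

lemma clinearI:
  assumes "\<And>x y. f (x + y) = f x + f y" "\<And>a x. f (a *\<^sub>C x) = a *\<^sub>C f x"
  shows "clinear f"
  using assms cvec.vector_space_axioms by (simp add: Vector_Spaces.linear_iff)

lemma cvec_subspace_imp_subspace: "cvec.subspace S \<Longrightarrow> subspace S"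
  using cvec.subspace_scale[of S _ "complex_of_real _"]
  by (auto simp: cvec.subspace_def subspace_def scaleC_of_real[symmetric])

lemma norm_scaleC:
  fixes x :: "'a::complex_hilbert_space"
  shows "norm (a *\<^sub>C x) = cmod a * norm x"
proof -
  have "cinner (a *\<^sub>C x) (a *\<^sub>C x) = (a * cnj a) * cinner x x"
    by (simp add: cinner_scaleC_left cinner_commute[of x "a *\<^sub>C x"]) (metis cinner_commute)
  then have "(norm (a *\<^sub>C x))\<^sup>2 = (cmod a)\<^sup>2 * (norm x)\<^sup>2"
    by (simp add: power2_norm_eq_inner[of x] power2_norm_eq_inner[of "a *\<^sub>C x"] inner_eq_Re_cinner
        complex_mult_cnj cmod_power2)
  then have "(norm (a *\<^sub>C x))\<^sup>2 = (cmod a * norm x)\<^sup>2" by (simp add: power_mult_distrib)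
  then show ?thesis by simp
qed

lemma cinner_scaleC_right: "cinner x (a *\<^sub>C y) = cnj a * cinner x y"
  by (metis cinner_commute cinner_scaleC_left complex_cnj_mult)

lemma cinner_self_eq_0: "cinner x x = 0 \<Longrightarrow> x = 0"
  using inner_eq_Re_cinner[of x x] by simp

lemma cmod_cinner_le: "cmod (cinner x y) \<le> norm x * norm y"
proof (cases "cinner x y = 0")
  case False
  \<comment> \<open>Multiplication by this unimodular scalar turns the inner product into its own
    modulus, so that the real Cauchy-Schwarz inequality applies.\<close>
  define a where "a = cnj (cinner x y) / cmod (cinner x y)"
  have "cinner (a *\<^sub>C x) y = cmod (cinner x y)"
    using False by (simp add: a_def cinner_scaleC_left complex_norm_square[symmetric] power2_eq_square mult.commute)
  then have "cmod (cinner x y) = inner (a *\<^sub>C x) y" by (simp add: inner_eq_Re_cinner)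
  also have "\<dots> \<le> norm (a *\<^sub>C x) * norm y" by (rule norm_cauchy_schwarz)
  also have "norm (a *\<^sub>C x) = norm x" using False by (simp add: norm_scaleC a_def norm_divide)
  finally show ?thesis .
qed simp

lemma bounded_clinearI:
  assumes "\<And>x y. f (x + y) = f x + f y" "\<And>a x. f (a *\<^sub>C x) = a *\<^sub>C f x"
    and "\<And>x. norm (f x) \<le> norm x * C"
  shows "bounded_clinear f"
  unfolding bounded_clinear_def
proof (intro conjI allI bounded_linear_intro[where K = C])
  show "f (r *\<^sub>R x) = r *\<^sub>R f x" for r x using assms(2)[of "complex_of_real r" x] by (simp add: scaleC_of_real)
qed (use assms in auto)

lemma bounded_clinear_imp_bounded_linear: "bounded_clinear f \<Longrightarrow> bounded_linear f"
  by (simp add: bounded_clinear_def)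

lemma bounded_clinear_imp_clinear: "bounded_clinear f \<Longrightarrow> clinear f"
  by (simp add: bounded_clinear_def clinearI linear_simps(1))

lemma bounded_clinear_scaleC: "bounded_clinear (\<lambda>x. a *\<^sub>C x)"
  by (rule bounded_clinearI[where C = "cmod a"])
    (simp_all add: scaleC_add_right scaleC_scaleC norm_scaleC mult.commute)

lemma bounded_clinear_id: "bounded_clinear (\<lambda>x. x)" and bounded_clinear_zero: "bounded_clinear (\<lambda>x. 0)"
  by (auto simp: bounded_clinear_def)

lemma bounded_clinear_add: "bounded_clinear f \<Longrightarrow> bounded_clinear g \<Longrightarrow> bounded_clinear (\<lambda>x. f x + g x)"
  by (auto simp: bounded_clinear_def bounded_linear_add scaleC_add_right)

lemma bounded_clinear_minus: "bounded_clinear f \<Longrightarrow> bounded_clinear (\<lambda>x. - f x)"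
  by (auto simp: bounded_clinear_def bounded_linear_minus)

lemma bounded_clinear_compose: "bounded_clinear f \<Longrightarrow> bounded_clinear g \<Longrightarrow> bounded_clinear (\<lambda>x. f (g x))"
  by (auto simp: bounded_clinear_def bounded_linear_compose)

lemma bounded_clinear_funpow: "bounded_clinear f \<Longrightarrow> bounded_clinear (f ^^ n)"
proof (induction n)
  case 0
  then show ?case using bounded_clinear_id by (simp add: id_def)
next
  case (Suc n)
  then show ?case using bounded_clinear_compose[of f "f ^^ n"] by (simp add: o_def)
qed

lemma bounded_clinear_shift: "bounded_clinear f \<Longrightarrow> bounded_clinear (op_shift f \<mu>)"
  unfolding op_shift_def diff_conv_add_uminus
  by (intro bounded_clinear_add bounded_clinear_minus bounded_clinear_scaleC)

lemma bounded_clinear_cinner_scaleC: "bounded_clinear (\<lambda>x. cinner x a *\<^sub>C d)"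
proof (rule bounded_clinearI[where C = "norm a * norm d"])
  show "norm (cinner x a *\<^sub>C d) \<le> norm x * (norm a * norm d)" for x
    using mult_right_mono[OF cmod_cinner_le[of x a], of "norm d"] by (simp add: norm_scaleC mult.assoc)
qed (simp_all add: cinner_add_left scaleC_add_left cinner_scaleC_left scaleC_scaleC)

lemma clinear_subspace_range: "clinear f \<Longrightarrow> cvec.subspace (range f)"
  using cvec_pair.linear_subspace_image[OF _ cvec.subspace_UNIV] .

lemma subspace_ker: "clinear f \<Longrightarrow> cvec.subspace (ker f)"
  unfolding ker_def by (rule cvec_pair.linear_subspace_kernel)

section \<open>Finite-dimensional subspaces\<close>

definition findim :: "'a::complex_hilbert_space set \<Rightarrow> bool" where
  "findim S \<longleftrightarrow> (\<exists>B. finite B \<and> S \<subseteq> cvec.span B)"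

lemma cdim_less_infinity_iff: "cdim S < \<infinity> \<longleftrightarrow> findim S"
  by (simp add: cdim_def findim_def)

lemma cdim_findim: "findim S \<Longrightarrow> cdim S = enat (cvec.dim S)"
  by (simp add: cdim_def findim_def)

lemma findim_subset: "findim T \<Longrightarrow> S \<subseteq> T \<Longrightarrow> findim S"
  unfolding findim_def by blast

lemma findim_span: "finite B \<Longrightarrow> findim (cvec.span B)"
  unfolding findim_def by blast

lemma findim_image:
  assumes f: "clinear f" and S: "findim S" shows "findim (f ` S)"
proof -
  obtain B where "finite B" "S \<subseteq> cvec.span B" using S unfolding findim_def by blast
  then show ?thesis unfolding findim_def
    using cvec_pair.linear_spans_image[OF f] by (intro exI[of _ "f ` B"]) blast
qed

lemma findim_sum:
  assumes "findim S" "findim T" shows "findim {x + y | x y. x \<in> S \<and> y \<in> T}"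
proof -
  obtain B C where "finite B" "S \<subseteq> cvec.span B" "finite C" "T \<subseteq> cvec.span C"
    using assms unfolding findim_def by blast
  then show ?thesis unfolding findim_def
    by (intro exI[of _ "B \<union> C"]) (auto simp: cvec.span_Un)
qed

lemma findim_basis:
  assumes "findim S" "cvec.subspace S"
  obtains B where "finite B" "cvec.independent B" "B \<subseteq> S" "cvec.span B = S" "card B = cvec.dim S"
proof -
  obtain D where D: "finite D" "S \<subseteq> cvec.span D" using assms unfolding findim_def by blast
  obtain B where B: "B \<subseteq> S" "cvec.independent B" "S \<subseteq> cvec.span B" "card B = cvec.dim S"
    using cvec.basis_exists by blast
  have "finite B" using cvec.independent_span_bound[OF D(1) B(2)] B(1) D(2) by blast
  moreover have "cvec.span B = S" using cvec.span_subspace[OF B(1,3) assms(2)] .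
  ultimately show ?thesis using that B by blast
qed

lemma findim_independent_bound:
  assumes S: "findim S" and B: "cvec.independent B" "B \<subseteq> S"
  shows "finite B" "card B \<le> cvec.dim S"
proof -
  obtain D where D: "finite D" "S \<subseteq> cvec.span D" using assms unfolding findim_def by blast
  obtain C where C: "C \<subseteq> S" "cvec.independent C" "S \<subseteq> cvec.span C" "card C = cvec.dim S"
    using cvec.basis_exists by blast
  have "finite C" using cvec.independent_span_bound[OF D(1) C(2)] C(1) D(2) by blast
  then show "finite B" "card B \<le> cvec.dim S"
    using cvec.independent_span_bound[of C B] B C by auto
qed

lemma findim_subspace_eqI:
  assumes "cvec.subspace S" "S \<subseteq> T" "findim T" "cvec.dim T \<le> cvec.dim S"
  shows "S = T"
proof (rule ccontr)
  assume "S \<noteq> T"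
  then obtain x where x: "x \<in> T" "x \<notin> S" using assms by blast
  obtain B where B: "finite B" "cvec.independent B" "B \<subseteq> S" "cvec.span B = S" "card B = cvec.dim S"
    using findim_basis assms findim_subset by metis
  have "cvec.independent (insert x B)" using x B cvec.independent_insertI by blast
  then have "card (insert x B) \<le> cvec.dim T" using findim_independent_bound assms x B by blast
  moreover have "x \<notin> B" using x B by blast
  ultimately show False using B assms by simp
qed

lemma findim_inj_imp_surj:
  assumes f: "clinear f" and V: "findim V" "cvec.subspace V"
    and inj: "\<And>x. x \<in> V \<Longrightarrow> f x = 0 \<Longrightarrow> x = 0" and fV: "f ` V \<subseteq> V"
  shows "f ` V = V"
proof (rule findim_subspace_eqI[OF _ fV V(1)])
  obtain B where B: "finite B" "cvec.independent B" "B \<subseteq> V" "cvec.span B = V" "card B = cvec.dim V"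
    using findim_basis V by metis
  have ij: "inj_on f (cvec.span B)" using cvec_pair.linear_inj_on_iff_eq_0[OF f V(2)] inj B(4) by blast
  then have "cvec.independent (f ` B)" by (rule cvec_pair.linear_independent_injective_image[OF f B(2)])
  moreover have "card (f ` B) = cvec.dim V"
    using ij B card_image inj_on_subset cvec.span_superset by metis
  moreover have "f ` V = cvec.span (f ` B)" using cvec_pair.linear_span_image[OF f] B by simp
  ultimately show "cvec.dim V \<le> cvec.dim (f ` V)" using cvec.dim_eq_card_independent[of "f ` B"] by simp
  show "cvec.subspace (f ` V)" using cvec_pair.linear_subspace_image[OF f V(2)] .
qed

text \<open>Steinitz exchange in the quotient by \<open>U\<close>. Each vector of \<open>I\<close>
  is congruent to one of \<open>span S\<close>; the linear extension \<open>h\<close> of this choice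
  is the identity modulo \<open>U\<close> on \<open>span I\<close>, hence injective there, because
  \<open>span I\<close> meets \<open>U\<close> only in 0.\<close>

lemma exchange_modulo_subspace:
  fixes U :: "'a::complex_hilbert_space set"
  assumes U: "cvec.subspace U" and I: "finite I" "cvec.independent I" "cvec.span I \<inter> U \<subseteq> {0}"
    and S: "finite S" "I \<subseteq> cvec.span (U \<union> S)"
  shows "card I \<le> card S"
proof -
  have "\<forall>i\<in>I. \<exists>s. s \<in> cvec.span S \<and> i - s \<in> U"
  proof
    fix i assume "i \<in> I"
    then obtain u s where "i = u + s" "u \<in> cvec.span U" "s \<in> cvec.span S"
      using S(2) by (auto simp: cvec.span_Un)
    moreover have "cvec.span U = U" using U cvec.span_eq_iff by blast
    ultimately show "\<exists>s. s \<in> cvec.span S \<and> i - s \<in> U" by (intro exI[of _ s]) simp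
  qed
  then obtain s where s: "\<And>i. i \<in> I \<Longrightarrow> s i \<in> cvec.span S" "\<And>i. i \<in> I \<Longrightarrow> i - s i \<in> U" by metis
  obtain h :: "'a \<Rightarrow> 'a" where h: "clinear h" "\<And>i. i \<in> I \<Longrightarrow> h i = s i"
    using cvec_pair.linear_independent_extend[OF I(2), of s] by blast
  have hU: "x - h x \<in> U" if "x \<in> cvec.span I" for x
    using that
  proof (induction rule: cvec.span_induct_alt)
    case base
    then show ?case using cvec_pair.linear_0[OF h(1)] cvec.subspace_0[OF U] by simp
  next
    case (step c x y)
    have "c *\<^sub>C x + y - h (c *\<^sub>C x + y) = c *\<^sub>C (x - h x) + (y - h y)"
      using h(1) by (simp add: cvec_pair.linear_add cvec_pair.linear_scale algebra_simps
          cvec.scale_right_diff_distrib)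
    moreover have "c *\<^sub>C (x - h x) + (y - h y) \<in> U"
      using U step s(2) h(2) cvec.subspace_add cvec.subspace_scale by metis
    ultimately show ?case by (simp only:)
  qed
  have "inj_on h (cvec.span I)"
    unfolding cvec_pair.linear_inj_on_iff_eq_0[OF h(1) cvec.subspace_span]
    using hU I(3) by fastforce
  then have "cvec.independent (h ` I)" "card (h ` I) = card I"
    using cvec_pair.linear_independent_injective_image[OF h(1) I(2)]
      card_image[OF inj_on_subset[OF _ cvec.span_superset]] by simp_all
  moreover have "h ` I \<subseteq> cvec.span S" using s(1) h(2) by auto
  ultimately show ?thesis using cvec.independent_span_bound[OF S(1)] by metis
qed

text \<open>For \<open>d\<close> outside \<open>S\<close>, the positive distance \<open>r\<close>
  from \<open>d\<close> to \<open>S\<close> bounds coefficients: \<open>cmod a * r\<close> is at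
  most the norm of \<open>m + a d\<close>. So the coefficients of \<open>d\<close> along a
  convergent sequence are Cauchy, and the components in \<open>S\<close> converge as well.\<close>

lemma closed_span_insert:
  fixes S :: "'a::complex_hilbert_space set"
  assumes S: "closed S" "cvec.subspace S"
  shows "closed (cvec.span (insert d S))"
proof (cases "d \<in> S")
  case True
  then have "cvec.span (insert d S) = S"
    using S(2) cvec.span_eq_iff by (simp add: insert_absorb)
  then show ?thesis using S(1) by simp
next
  case False
  have spanS: "cvec.span S = S" using S(2) cvec.span_eq_iff by blast
  define r where "r = infdist d S"
  have r: "r > 0"
    using False S in_closed_iff_infdist_zero[of S d] infdist_nonneg[of d S] cvec.subspace_0[OF S(2)]
    unfolding r_def by fastforce
  have low: "cmod a * r \<le> norm (m + a *\<^sub>C d)" if m: "m \<in> S" for a m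
  proof (cases "a = 0")
    case False
    have "- (inverse a *\<^sub>C m) \<in> S" using m S(2) cvec.subspace_scale cvec.subspace_neg by blast
    then have "r \<le> norm (d + inverse a *\<^sub>C m)"
      unfolding r_def using infdist_le[of _ S d] by (fastforce simp: dist_norm)
    then have "cmod a * r \<le> norm (a *\<^sub>C (d + inverse a *\<^sub>C m))"
      by (simp add: norm_scaleC mult_left_mono)
    also have "a *\<^sub>C (d + inverse a *\<^sub>C m) = m + a *\<^sub>C d"
      using False by (simp add: scaleC_add_right scaleC_scaleC)
    finally show ?thesis .
  qed simp
  show ?thesis
    unfolding closed_sequential_limits
  proof (intro allI impI, elim conjE)
    fix y l assume y: "\<forall>n. y n \<in> cvec.span (insert d S)" and lim: "y \<longlonglongrightarrow> l"
    have "\<forall>n. \<exists>a. y n - a *\<^sub>C d \<in> S" using y by (auto simp: cvec.span_insert spanS)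
    then obtain a where a: "\<And>n. y n - a n *\<^sub>C d \<in> S" by metis
    have "cmod (a i - a j) * r \<le> dist (y i) (y j)" for i j
    proof -
      have "(y i - a i *\<^sub>C d) - (y j - a j *\<^sub>C d) \<in> S" using a S(2) cvec.subspace_diff by blast
      from low[OF this, of "a i - a j"] show ?thesis
        by (simp add: cvec.scale_left_diff_distrib dist_norm algebra_simps)
    qed
    then have da: "dist (a i) (a j) \<le> dist (y i) (y j) / r" for i j
      using r by (simp add: dist_norm field_simps)
    have "Cauchy a"
    proof (rule metric_CauchyI)
      fix e :: real assume "e > 0"
      then have "e * r > 0" using r by simp
      then obtain N where N: "\<And>i j. i \<ge> N \<Longrightarrow> j \<ge> N \<Longrightarrow> dist (y i) (y j) < e * r"
        using metric_CauchyD[OF LIMSEQ_imp_Cauchy[OF lim]] by blast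
      have "dist (a i) (a j) < e" if "i \<ge> N" "j \<ge> N" for i j
      proof -
        have "dist (y i) (y j) / r < e" using N[OF that] r by (simp add: field_simps)
        then show ?thesis using da[of i j] by linarith
      qed
      then show "\<exists>N. \<forall>i\<ge>N. \<forall>j\<ge>N. dist (a i) (a j) < e" by blast
    qed
    then obtain b where b: "a \<longlonglongrightarrow> b" using Cauchy_convergent_iff convergent_def by blast
    have "(\<lambda>n. a n *\<^sub>C d) \<longlonglongrightarrow> b *\<^sub>C d"
    proof (rule tendstoI)
      fix e :: real assume e: "e > 0"
      have "\<forall>\<^sub>F n in sequentially. dist (a n) b < e / (norm d + 1)"
        using b e by (intro tendstoD) (auto intro!: divide_pos_pos add_nonneg_pos)
      then show "\<forall>\<^sub>F n in sequentially. dist (a n *\<^sub>C d) (b *\<^sub>C d) < e"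
      proof eventually_elim
        case (elim n)
        have p: "norm d + 1 > 0" by (simp add: add_nonneg_pos)
        have "dist (a n *\<^sub>C d) (b *\<^sub>C d) = dist (a n) b * norm d"
          by (simp add: dist_norm cvec.scale_left_diff_distrib[symmetric] norm_scaleC)
        also have "\<dots> \<le> dist (a n) b * (norm d + 1)" by (intro mult_left_mono) auto
        also have "\<dots> < e" using elim p by (simp add: field_simps)
        finally show ?case .
      qed
    qed
    then have "(\<lambda>n. y n - a n *\<^sub>C d) \<longlonglongrightarrow> l - b *\<^sub>C d" using lim by (intro tendsto_diff)
    then have "l - b *\<^sub>C d \<in> S" using closed_sequentially[OF S(1), of "\<lambda>n. y n - a n *\<^sub>C d"] a by simp
    then show "l \<in> cvec.span (insert d S)" by (auto simp: cvec.span_insert spanS)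
  qed
qed

lemma closed_span_Un_finite:
  fixes S :: "'a::complex_hilbert_space set"
  assumes S: "closed S" "cvec.subspace S" and B: "finite B"
  shows "closed (cvec.span (S \<union> B))"
  using B
proof (induction B rule: finite_induct)
  case empty
  have "cvec.span S = S" using S(2) cvec.span_eq_iff by blast
  then show ?case using S(1) by (simp only: Un_empty_right)
next
  case (insert b B)
  have "cvec.span (S \<union> insert b B) = cvec.span (insert b (cvec.span (S \<union> B)))"
  proof (rule cvec.span_eq[THEN iffD2], intro conjI subsetI)
    fix x assume "x \<in> S \<union> insert b B"
    then show "x \<in> cvec.span (insert b (cvec.span (S \<union> B)))"
      by (auto intro: cvec.span_base)
  next
    fix x assume "x \<in> insert b (cvec.span (S \<union> B))"
    moreover have "cvec.span (S \<union> B) \<subseteq> cvec.span (S \<union> insert b B)"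
      by (rule cvec.span_mono) auto
    ultimately show "x \<in> cvec.span (S \<union> insert b B)" by (auto intro: cvec.span_base)
  qed
  then show ?case using closed_span_insert[OF insert.IH cvec.subspace_span] by simp
qed

section \<open>Bounded below and invertible operators\<close>

lemma bounded_below_imp_ker:
  fixes A :: "'a::complex_hilbert_space \<Rightarrow> 'a"
  assumes "bounded_below_op A" "bounded_clinear A"
  shows "ker A = {0}"
proof -
  obtain c where c: "c > 0" "\<And>x. c * norm x \<le> norm (A x)"
    using assms unfolding bounded_below_op_def by blast
  have "x = 0" if "A x = 0" for x
    using c(2)[of x] c(1) that by (simp add: mult_le_0_iff)
  moreover have "A 0 = 0" using cvec_pair.linear_0[OF bounded_clinear_imp_clinear[OF assms(2)]] .
  ultimately show ?thesis unfolding ker_def by blast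
qed

lemma bounded_below_closed_image:
  fixes A :: "'a::complex_hilbert_space \<Rightarrow> 'a"
  assumes "bounded_below_op A" "bounded_clinear A" "closed S" "cvec.subspace S"
  shows "closed (A ` S)"
proof -
  obtain c where c: "c > 0" "\<And>x. c * norm x \<le> norm (A x)"
    using assms unfolding bounded_below_op_def by blast
  have "complete (A ` S)"
    by (rule complete_isometric_image[OF c(1) cvec_subspace_imp_subspace[OF assms(4)]
          bounded_clinear_imp_bounded_linear[OF assms(2)]])
      (use c assms in \<open>auto simp: complete_eq_closed\<close>)
  then show ?thesis by (simp add: complete_eq_closed)
qed

lemma closed_ker: "bounded_clinear A \<Longrightarrow> closed (ker A)"
  unfolding ker_def
  by (intro closed_Collect_eq linear_continuous_on continuous_on_const bounded_clinear_imp_bounded_linear)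

lemma ker_inj:
  assumes "clinear A" "ker A = {0}" "A x = A y" shows "x = y"
proof -
  have "x - y \<in> ker A" using assms(3) cvec_pair.linear_diff[OF assms(1), of x y] by (simp add: ker_def)
  then show ?thesis using assms(2) by (metis eq_iff_diff_eq_0 singletonD)
qed

lemma open_mapping_range:
  fixes A :: "'a::complex_hilbert_space \<Rightarrow> 'a"
  assumes "bounded_clinear A" "closed (range A)"
  shows "\<exists>C>0. \<forall>y\<in>range A. \<exists>x. A x = y \<and> norm x \<le> C * norm y"
  using open_mapping_subspace[OF bounded_clinear_imp_bounded_linear[OF assms(1)], of UNIV] assms by simp

lemma bounded_below_op_iff:
  fixes A :: "'a::complex_hilbert_space \<Rightarrow> 'a"
  assumes A: "bounded_clinear A"
  shows "bounded_below_op A \<longleftrightarrow> closed (range A) \<and> ker A = {0}"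
proof
  assume "bounded_below_op A"
  then show "closed (range A) \<and> ker A = {0}"
    using bounded_below_imp_ker A bounded_below_closed_image[OF _ A, of UNIV] by simp
next
  assume R: "closed (range A) \<and> ker A = {0}"
  then obtain C where C: "C > 0" "\<forall>y\<in>range A. \<exists>x. A x = y \<and> norm x \<le> C * norm y"
    using open_mapping_range[OF A conjunct1[OF R]] by meson
  have "1/C * norm x \<le> norm (A x)" for x
  proof -
    obtain x' where "A x' = A x" "norm x' \<le> C * norm (A x)" using C(2) by blast
    moreover from this have "x' = x" using ker_inj[OF bounded_clinear_imp_clinear[OF A]] R by blast
    ultimately show ?thesis using C(1) by (simp add: field_simps)
  qed
  then show "bounded_below_op A" unfolding bounded_below_op_def using C(1) by (intro exI[of _ "1/C"]) simp
qed

lemma op_invertible_iff: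
  fixes A :: "'a::complex_hilbert_space \<Rightarrow> 'a"
  assumes A: "bounded_clinear A"
  shows "op_invertible A \<longleftrightarrow> ker A = {0} \<and> range A = UNIV"
proof
  have lin: "clinear A" using bounded_clinear_imp_clinear[OF A] .
  assume "op_invertible A"
  then obtain S where S: "S \<circ> A = id" "A \<circ> S = id" "bounded_clinear S" unfolding op_invertible_def by blast
  have "x = 0" if "A x = 0" for x
    using S(1) that cvec_pair.linear_0[OF bounded_clinear_imp_clinear[OF S(3)]] by (metis comp_apply id_apply)
  moreover have "y \<in> range A" for y using S(2) by (metis comp_apply id_apply rangeI)
  ultimately show "ker A = {0} \<and> range A = UNIV"
    using cvec_pair.linear_0[OF lin] unfolding ker_def by blast
next
  have lin: "clinear A" using bounded_clinear_imp_clinear[OF A] .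
  assume R: "ker A = {0} \<and> range A = UNIV"
  have inj: "A x = A y \<Longrightarrow> x = y" for x y using ker_inj[OF lin] R by blast
  obtain C where C: "\<forall>y. \<exists>x. A x = y \<and> norm x \<le> C * norm y"
    using open_mapping_range[OF A] R by (metis UNIV_I closed_UNIV)
  then obtain S where S: "\<And>y. A (S y) = y" "\<And>y. norm (S y) \<le> C * norm y" by metis
  have "bounded_clinear S"
  proof (rule bounded_clinearI[where C = C])
    show "S (x + y) = S x + S y" for x y
      by (rule inj) (simp add: S cvec_pair.linear_add[OF lin])
    show "S (a *\<^sub>C x) = a *\<^sub>C S x" for a x
      by (rule inj) (simp add: S cvec_pair.linear_scale[OF lin])
    show "norm (S x) \<le> norm x * C" for x using S(2)[of x] by (simp add: mult.commute)
  qed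
  moreover have "S \<circ> A = id" "A \<circ> S = id" using S(1) inj by fastforce+
  ultimately show "op_invertible A" unfolding op_invertible_def by blast
qed

lemma op_invertible_imp_bounded_below:
  fixes A :: "'a::complex_hilbert_space \<Rightarrow> 'a"
  assumes "bounded_clinear A" "op_invertible A" shows "bounded_below_op A"
  using assms by (simp add: bounded_below_op_iff op_invertible_iff)

text \<open>The preimage \<open>L = M + ker A\<close> of the image of \<open>M\<close> is closed
  because the kernel is finite-dimensional, and the open mapping theorem lifts a convergent sequence
  of images to a convergent sequence in \<open>L\<close>. Iteration gives closed ranges for all
  powers.\<close>

lemma closed_image_closed_subspace:
  fixes A :: "'a::complex_hilbert_space \<Rightarrow> 'a"
  assumes A: "bounded_clinear A" "closed (range A)" "findim (ker A)"
    and M: "closed M" "cvec.subspace M"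
  shows "closed (A ` M)"
proof -
  have lin: "clinear A" using bounded_clinear_imp_clinear[OF A(1)] .
  obtain B where B: "finite B" "cvec.span B = ker A"
    using findim_basis[OF A(3) subspace_ker[OF lin]] by metis
  define L where "L = cvec.span (M \<union> B)"
  have L: "closed L" unfolding L_def by (rule closed_span_Un_finite[OF M B(1)])
  have spanM: "cvec.span M = M" using M(2) cvec.span_eq_iff by blast
  have memL: "x \<in> L \<longleftrightarrow> (\<exists>m\<in>M. x - m \<in> ker A)" for x
  proof
    show "x \<in> L \<Longrightarrow> \<exists>m\<in>M. x - m \<in> ker A" unfolding L_def cvec.span_Un B(2) spanM by force
    assume "\<exists>m\<in>M. x - m \<in> ker A"
    then obtain m where m: "m \<in> M" "x - m \<in> ker A" by blast
    then have "x = m + (x - m)" by simp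
    then show "x \<in> L" unfolding L_def cvec.span_Un B(2) spanM using m by blast
  qed
  obtain C where C: "\<And>y. y \<in> range A \<Longrightarrow> \<exists>x. A x = y \<and> norm x \<le> C * norm y"
    using open_mapping_range[OF A(1,2)] by meson
  show ?thesis
    unfolding closed_sequential_limits
  proof (intro allI impI, elim conjE)
    fix y l assume y: "\<forall>n. y n \<in> A ` M" and lim: "y \<longlonglongrightarrow> l"
    have "\<forall>n. \<exists>x. x \<in> M \<and> A x = y n" using y by (metis imageE)
    then obtain x where x: "\<And>n. x n \<in> M" "\<And>n. A (x n) = y n" by metis
    have "y n \<in> range A" for n using x(2)[of n] by (metis rangeI)
    then have "l \<in> range A" using closed_sequentially[OF A(2) _ lim] by simp
    then obtain w where w: "A w = l" by blast
    have "\<exists>z. A z = y n - l \<and> norm z \<le> C * norm (y n - l)" for n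
    proof -
      have "y n - l = A (x n - w)" by (simp add: cvec_pair.linear_diff[OF lin] x w)
      then show ?thesis using C by blast
    qed
    then obtain z where z: "\<And>n. A (z n) = y n - l" "\<And>n. norm (z n) \<le> C * norm (y n - l)" by metis
    have "(\<lambda>n. norm (y n - l)) \<longlonglongrightarrow> 0" using lim by (simp add: LIM_zero_iff tendsto_norm_zero)
    then have "(\<lambda>n. C * norm (y n - l)) \<longlonglongrightarrow> 0" by (rule tendsto_mult_right_zero)
    then have "z \<longlonglongrightarrow> 0" by (rule Lim_null_comparison[OF always_eventually, rotated]) (use z in blast)
    then have "(\<lambda>n. w + z n) \<longlonglongrightarrow> w + 0" by (intro tendsto_intros)
    moreover have "w + z n \<in> L" for n
      unfolding memL by (rule bexI[OF _ x(1)[of n]])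
        (simp add: ker_def cvec_pair.linear_diff[OF lin] cvec_pair.linear_add[OF lin] x w z)
    ultimately have "w \<in> L" using closed_sequentially[OF L, of "\<lambda>n. w + z n"] by simp
    then obtain m where "m \<in> M" "w - m \<in> ker A" using memL by blast
    then have "A m = l" using w by (simp add: ker_def cvec_pair.linear_diff[OF lin])
    then show "l \<in> A ` M" using \<open>m \<in> M\<close> by blast
  qed
qed

lemma range_funpow_Suc: "range (A ^^ Suc n) = A ` range (A ^^ n)"
  by (simp add: image_comp)

lemma closed_range_funpow:
  fixes A :: "'a::complex_hilbert_space \<Rightarrow> 'a"
  assumes A: "bounded_clinear A" "closed (range A)" "findim (ker A)"
  shows "closed (range (A ^^ n))"
proof (induction n)
  case (Suc n)
  have "cvec.subspace (range (A ^^ n))"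
    using clinear_subspace_range bounded_clinear_imp_clinear bounded_clinear_funpow[OF A(1)] by blast
  then show ?case unfolding range_funpow_Suc using closed_image_closed_subspace[OF A Suc] by blast
qed simp

section \<open>Finite rank perturbations\<close>

lemma finite_rank_iff: "finite_rank F \<longleftrightarrow> findim (range F)"
  unfolding finite_rank_def by (rule cdim_less_infinity_iff)

lemma finite_rank_add: "finite_rank F \<Longrightarrow> finite_rank G \<Longrightarrow> finite_rank (\<lambda>x. F x + G x)"
  unfolding finite_rank_iff
  by (rule findim_subset[OF findim_sum[of "range F" "range G"]]) auto

lemma finite_rank_compose_left: "clinear A \<Longrightarrow> finite_rank F \<Longrightarrow> finite_rank (\<lambda>x. A (F x))"
  unfolding finite_rank_iff using findim_image[of A "range F"] by (simp add: image_image)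

lemma finite_rank_compose_right: "finite_rank F \<Longrightarrow> finite_rank (\<lambda>x. F (A x))"
  unfolding finite_rank_iff by (erule findim_subset) auto

lemma finite_rank_minus: "finite_rank F \<Longrightarrow> finite_rank (\<lambda>x. - F x)"
  using finite_rank_compose_left[of "\<lambda>x. - x" F] bounded_clinear_imp_clinear[OF bounded_clinear_minus[OF bounded_clinear_id]]
  by simp

lemma finite_rank_scaleC_range: "finite_rank (\<lambda>x. f x *\<^sub>C d)"
  unfolding finite_rank_iff
  by (rule findim_subset[OF findim_span[of "{d}"]]) (auto intro: cvec.span_scale cvec.span_base)

lemma finite_rank_zero: "finite_rank (\<lambda>x. 0)"
  unfolding finite_rank_iff by (rule findim_subset[OF findim_span[of "{}"]]) auto

text \<open>\<open>E\<close> is a basis of a complement of \<open>ker G\<close>: the image of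
  \<open>N\<close> is extended to a basis \<open>W\<close> of the range, and \<open>W\<close> is
  lifted by a linear section \<open>h\<close> of \<open>G\<close> that sends \<open>G n\<close> back
  to \<open>n\<close>. Prescribing \<open>N\<close> places a kernel on which \<open>G\<close> is
  injective inside the complement; \<open>N = {}\<close> just gives some complement.\<close>

lemma finite_rank_ker_complement:
  fixes G :: "'a::complex_hilbert_space \<Rightarrow> 'a"
  assumes G: "clinear G" "finite_rank G" and N: "cvec.independent N" "inj_on G (cvec.span N)"
  obtains E where "finite E" "N \<subseteq> E" "cvec.independent E" "inj_on G (cvec.span E)"
    "cvec.span (ker G \<union> E) = UNIV"
proof -
  have iGN: "cvec.independent (G ` N)" using cvec_pair.linear_independent_injective_image[OF G(1) N] .
  obtain W where W: "G ` N \<subseteq> W" "W \<subseteq> range G" "cvec.independent W" "range G \<subseteq> cvec.span W"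
    using cvec.maximal_independent_subset_extend[OF _ iGN, of "range G"] by blast
  have fW: "finite W" using findim_independent_bound(1)[OF _ W(3,2)] G(2) by (simp add: finite_rank_iff)
  have injN: "inj_on G N" using N(2) inj_on_subset cvec.span_superset by blast
  define g where "g w = (if w \<in> G ` N then inv_into N G w else inv_into UNIV G w)" for w
  have Gg: "G (g w) = w" if "w \<in> W" for w
    using that W(2) by (auto simp: g_def f_inv_into_f subsetD)
  have gG: "g (G n) = n" if "n \<in> N" for n
    using that injN by (simp add: g_def)
  obtain h :: "'a \<Rightarrow> 'a" where h: "clinear h" "\<And>w. w \<in> W \<Longrightarrow> h w = g w"
    using cvec_pair.linear_independent_extend[OF W(3), of g] by blast
  have Gh: "G (h w) = w" if "w \<in> cvec.span W" for w
  proof (rule cvec_pair.linear_eq_on[of "\<lambda>w. G (h w)" "\<lambda>w. w" w W])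
    show "clinear (\<lambda>w. G (h w))"
      using G(1) h(1) by (intro clinearI) (simp_all add: cvec_pair.linear_add cvec_pair.linear_scale)
    show "clinear (\<lambda>w. w)" by (intro clinearI) auto
  qed (use that Gg h in auto)
  define E where "E = h ` W"
  have spanE: "cvec.span E = h ` cvec.span W" unfolding E_def by (rule cvec_pair.linear_span_image[OF h(1)])
  have "inj_on h (cvec.span W)" by (rule inj_on_inverseI[of _ G]) (rule Gh)
  then have "cvec.independent E"
    unfolding E_def by (rule cvec_pair.linear_independent_injective_image[OF h(1) W(3)])
  moreover have "N \<subseteq> E"
  proof
    fix n assume "n \<in> N"
    then have "h (G n) = n" "G n \<in> W" using h(2) W(1) gG by auto
    then show "n \<in> E" unfolding E_def by force
  qed
  moreover have "inj_on G (cvec.span E)"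
    by (rule inj_on_inverseI[of _ h]) (auto simp: spanE Gh)
  moreover have "x \<in> cvec.span (ker G \<union> E)" for x
  proof -
    have m: "G x \<in> cvec.span W" using W(4) by blast
    have "x - h (G x) \<in> ker G" using Gh[OF m] by (simp add: ker_def cvec_pair.linear_diff[OF G(1)])
    then have "x - h (G x) \<in> cvec.span (ker G)" by (rule cvec.span_base)
    moreover have "h (G x) \<in> cvec.span E" using m spanE by blast
    moreover have "x = (x - h (G x)) + h (G x)" by simp
    ultimately show ?thesis unfolding cvec.span_Un by blast
  qed
  moreover have "finite E" using fW by (simp add: E_def)
  ultimately show ?thesis using that by blast
qed

text \<open>On \<open>ker G\<close> the sum agrees with \<open>B\<close>. For finite
  \<open>E\<close> its range is therefore an image under \<open>B\<close> enlarged by finitely many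
  vectors, from which both closedness and the dimension count are read off.\<close>

lemma finite_rank_perturbation_range:
  assumes B: "clinear B" and G: "clinear G" and E: "cvec.span (ker G \<union> E) = UNIV"
  shows "range (\<lambda>x. B x + G x) = cvec.span (B ` ker G \<union> (\<lambda>x. B x + G x) ` E)"
proof -
  have A: "clinear (\<lambda>x. B x + G x)"
    using B G by (intro clinearI) (simp_all add: cvec_pair.linear_add cvec_pair.linear_scale scaleC_add_right)
  have "range (\<lambda>x. B x + G x) = (\<lambda>x. B x + G x) ` cvec.span (ker G \<union> E)" using E by simp
  also have "\<dots> = cvec.span ((\<lambda>x. B x + G x) ` (ker G \<union> E))"
    by (rule cvec_pair.linear_span_image[OF A, symmetric])
  also have "(\<lambda>x. B x + G x) ` (ker G \<union> E) = B ` ker G \<union> (\<lambda>x. B x + G x) ` E"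
    unfolding image_Un by (simp add: ker_def)
  finally show ?thesis .
qed

text \<open>On this kernel \<open>G x = - B x\<close>, so injectivity of \<open>B\<close> passes to
  \<open>G\<close> and the kernel embeds in the finite-dimensional range of
  \<open>G\<close>.\<close>

lemma finite_rank_perturbation_ker:
  assumes B: "clinear B" "ker B = {0}" and G: "clinear G" "finite_rank G"
  shows "findim (ker (\<lambda>x. B x + G x))" "inj_on G (ker (\<lambda>x. B x + G x))"
proof -
  let ?N = "ker (\<lambda>x. B x + G x)"
  have "clinear (\<lambda>x. B x + G x)"
    using B G by (intro clinearI) (simp_all add: cvec_pair.linear_add cvec_pair.linear_scale scaleC_add_right)
  then have N: "cvec.subspace ?N" by (rule subspace_ker)
  have z: "x = 0" if "x \<in> ?N" "G x = 0" for x
  proof -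
    have "x \<in> ker B" using that by (simp add: ker_def)
    then show ?thesis using B by simp
  qed
  show inj: "inj_on G ?N" unfolding cvec_pair.linear_inj_on_iff_eq_0[OF G(1) N] using z by blast
  obtain C where C: "C \<subseteq> ?N" "cvec.independent C" "?N \<subseteq> cvec.span C"
    using cvec.basis_exists by metis
  have sC: "cvec.span C = ?N" using cvec.span_subspace[OF C(1,3) N] .
  have "cvec.independent (G ` C)"
    using cvec_pair.linear_independent_injective_image[OF G(1) C(2)] inj sC by simp
  then have "finite (G ` C)" using findim_independent_bound(1)[of "range G" "G ` C"] G(2)
    by (auto simp: finite_rank_iff)
  then have "finite C" using inj C(1) finite_imageD inj_on_subset by metis
  then show "findim ?N" using C(3) unfolding findim_def by blast
qed

text \<open>Compare dimensions modulo \<open>B (ker G)\<close>, on which \<open>B + G\<close> and \<open>B\<close> agree: the image under \<open>B\<close> of a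
  complement of \<open>ker G\<close> stays independent, while its image under \<open>B + G\<close> loses the nullity.\<close>

lemma finite_rank_perturbation_nullity_le_defect:
  fixes B G :: "'a::complex_hilbert_space \<Rightarrow> 'a"
  assumes B: "clinear B" "ker B = {0}" and G: "clinear G" "finite_rank G"
  shows "nullity (\<lambda>x. B x + G x) \<le> defect (\<lambda>x. B x + G x)"
proof -
  define A where "A = (\<lambda>x. B x + G x)"
  have A: "clinear A"
    unfolding A_def using B G
    by (intro clinearI) (simp_all add: cvec_pair.linear_add cvec_pair.linear_scale scaleC_add_right)
  have finN: "findim (ker A)" and injN: "inj_on G (ker A)"
    unfolding A_def by (rule finite_rank_perturbation_ker[OF B G])+
  obtain N where N: "finite N" "cvec.independent N" "cvec.span N = ker A" "card N = cvec.dim (ker A)"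
    using findim_basis[OF finN subspace_ker[OF A]] by metis
  obtain E where E: "finite E" "N \<subseteq> E" "cvec.independent E" "inj_on G (cvec.span E)"
    "cvec.span (ker G \<union> E) = UNIV"
    using finite_rank_ker_complement[OF G N(2)] injN N(3) by metis
  have injB: "inj_on B V" for V using ker_inj[OF B] by (auto intro: inj_onI)
  have U: "cvec.subspace (B ` ker G)"
    by (rule cvec_pair.linear_subspace_image[OF B(1) subspace_ker[OF G(1)]])
  have I: "cvec.independent (B ` E)" "card (B ` E) = card E" "finite (B ` E)"
    using cvec_pair.linear_independent_injective_image[OF B(1) E(3) injB] card_image[OF injB] E(1) by auto
  have IU: "cvec.span (B ` E) \<inter> B ` ker G \<subseteq> {0}"
  proof
    fix y assume "y \<in> cvec.span (B ` E) \<inter> B ` ker G"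
    then obtain e l where e: "e \<in> cvec.span E" "y = B e" "l \<in> ker G" "y = B l"
      using cvec_pair.linear_span_image[OF B(1), of E] by auto
    then have "e = l" using ker_inj[OF B] by simp
    then have "G e = G 0" using e cvec_pair.linear_0[OF G(1)] by (simp add: ker_def)
    then have "e = 0" using E(4) e(1) cvec.span_zero by (metis inj_onD)
    then show "y \<in> {0}" using e cvec_pair.linear_0[OF B(1)] by simp
  qed
  have "nullity A \<le> defect A"
    unfolding defect_def ccodim_def
  proof (rule Inf_greatest, safe)
    fix D assume D: "finite D" "cvec.span (range A \<union> D) = UNIV"
    \<comment> \<open>\<open>A\<close> kills \<open>N\<close>, so modulo \<open>B (ker G)\<close>
      the images of \<open>E - N\<close> together with \<open>D\<close> span everything. They must
      be at least as many as the \<open>card E\<close> vectors \<open>B e\<close>, which are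
      independent modulo \<open>B (ker G)\<close>.\<close>
    let ?S = "A ` (E - N) \<union> D"
    have N0: "A n = 0" if "n \<in> N" for n
      using cvec.span_base[OF that] N(3) by (simp add: ker_def)
    have "A ` E \<subseteq> cvec.span (B ` ker G \<union> ?S)"
    proof (intro image_subsetI)
      fix e assume "e \<in> E"
      then show "A e \<in> cvec.span (B ` ker G \<union> ?S)"
        by (cases "e \<in> N") (auto simp: N0 cvec.span_zero intro: cvec.span_base)
    qed
    moreover have "B ` ker G \<subseteq> cvec.span (B ` ker G \<union> ?S)" by (auto intro: cvec.span_base)
    ultimately have "cvec.span (B ` ker G \<union> A ` E) \<subseteq> cvec.span (B ` ker G \<union> ?S)"
      by (intro cvec.span_minimal) auto
    then have "range A \<subseteq> cvec.span (B ` ker G \<union> ?S)"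
      using finite_rank_perturbation_range[OF B(1) G(1) E(5)] by (simp add: A_def)
    moreover have "D \<subseteq> cvec.span (B ` ker G \<union> ?S)" by (auto intro: cvec.span_base)
    ultimately have "cvec.span (range A \<union> D) \<subseteq> cvec.span (B ` ker G \<union> ?S)"
      by (intro cvec.span_minimal) auto
    then have "B ` E \<subseteq> cvec.span (B ` ker G \<union> ?S)" using D(2) by blast
    then have "card (B ` E) \<le> card ?S"
      using D(1) E(1) by (intro exchange_modulo_subspace[OF U I(3,1) IU]) auto
    also have "\<dots> \<le> card (A ` (E - N)) + card D" by (rule card_Un_le)
    also have "card (A ` (E - N)) \<le> card (E - N)" using E(1) by (simp add: card_image_le)
    also have "card (E - N) = card E - card N" using E(2) N(1) by (rule card_Diff_subset[rotated])
    finally have "card E \<le> card E - card N + card D" using I(2) by simp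
    moreover have "card N \<le> card E" using E(1,2) by (rule card_mono)
    ultimately have "cvec.dim (ker A) \<le> card D" using N(4) by simp
    then show "nullity A \<le> enat (card D)" by (simp add: nullity_def cdim_findim[OF finN])
  qed
  then show ?thesis by (simp add: A_def)
qed

text \<open>An index \<open>\<le> 0\<close> and a finite defect force a finite nullity, so the lower semi-Fredholm alternative is redundant.\<close>

lemma upper_semi_weyl_alt:
  fixes A :: "'a::complex_hilbert_space \<Rightarrow> 'a"
  shows "upper_semi_weyl A \<longleftrightarrow> closed (range A) \<and> findim (ker A) \<and> nullity A \<le> defect A"
proof -
  have "fredholm_index A \<le> 0 \<longleftrightarrow> nullity A \<le> defect A" if "nullity A < \<infinity> \<or> defect A < \<infinity>"
    using that by (cases "nullity A"; cases "defect A") (auto simp: fredholm_index_def)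
  then show ?thesis
    unfolding upper_semi_weyl_def semi_fredholm_def upper_semi_fredholm_def lower_semi_fredholm_def
    using cdim_less_infinity_iff[of "ker A"] order.strict_trans1[of "nullity A" "defect A" \<infinity>]
    by (auto simp: nullity_def)
qed

text \<open>Induction on the nullity. For a kernel vector \<open>a\<close> and a vector
  \<open>d\<close> outside the range, adding the rank one term \<open>cinner x a *\<^sub>C d\<close>
  removes \<open>a\<close> from the kernel and adds \<open>d\<close> to the range. The nullity drops
  by at least one and the defect by at most one, so the inequality survives.\<close>

lemma upper_semi_weyl_imp_finite_rank_perturbation:
  fixes A :: "'a::complex_hilbert_space \<Rightarrow> 'a"
  assumes "bounded_clinear A" "closed (range A)" "findim (ker A)" "nullity A \<le> defect A"
  shows "\<exists>F. bounded_clinear F \<and> finite_rank F \<and> bounded_below_op (\<lambda>x. A x + F x)"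
  using assms
proof (induction "cvec.dim (ker A)" arbitrary: A rule: less_induct)
  case less
  note A = less.prems
  have lin: "clinear A" using bounded_clinear_imp_clinear[OF A(1)] .
  show ?case
  proof (cases "ker A = {0}")
    case True
    then have "bounded_below_op A" using A bounded_below_op_iff by blast
    then show ?thesis using bounded_clinear_zero finite_rank_zero by (intro exI[of _ "\<lambda>x. 0"]) simp
  next
    case False
    moreover have "0 \<in> ker A" using cvec_pair.linear_0[OF lin] by (simp add: ker_def)
    ultimately obtain a where a: "a \<in> ker A" "a \<noteq> 0" by blast
    have "cvec.dim (ker A) \<noteq> 0"
    proof
      assume "cvec.dim (ker A) = 0"
      then obtain B where "finite B" "cvec.span B = ker A" "card B = 0"
        using findim_basis[OF A(3) subspace_ker[OF lin]] by metis
      then show False using a by auto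
    qed
    \<comment> \<open>A nonzero nullity forces a nonzero defect, which supplies
      \<open>d\<close>.\<close>
    then have "range A \<noteq> UNIV"
      using A(4) unfolding nullity_def cdim_findim[OF A(3)] defect_def ccodim_def
    proof (intro notI)
      assume U: "range A = UNIV" and "cvec.dim (ker A) \<noteq> 0"
        and le: "enat (cvec.dim (ker A)) \<le> Inf {enat (card B) |B. finite B \<and> cvec.span (range A \<union> B) = UNIV}"
      have "Inf {enat (card B) |B. finite B \<and> cvec.span (range A \<union> B) = UNIV} \<le> enat (card ({}::'a set))"
        by (rule Inf_lower, rule CollectI, rule exI[of _ "{}"]) (simp add: U)
      then have "enat (cvec.dim (ker A)) \<le> enat (card ({}::'a set))" using le by (rule order_trans[rotated])
      then show False using \<open>cvec.dim (ker A) \<noteq> 0\<close> by simp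
    qed
    then obtain d where d: "d \<notin> range A" by blast
    define F0 where "F0 = (\<lambda>x. cinner x a *\<^sub>C d)"
    define A' where "A' = (\<lambda>x. A x + F0 x)"
    have F0: "bounded_clinear F0" "finite_rank F0"
      unfolding F0_def by (rule bounded_clinear_cinner_scaleC finite_rank_scaleC_range)+
    have A': "bounded_clinear A'" unfolding A'_def by (rule bounded_clinear_add[OF A(1) F0(1)])
    have spanR: "cvec.span (range A) = range A" using clinear_subspace_range[OF lin] cvec.span_eq_iff by blast
    have kersub: "ker A' \<subseteq> ker A" "\<And>x. x \<in> ker A' \<Longrightarrow> cinner x a = 0"
    proof -
      have "cinner x a = 0" if x: "x \<in> ker A'" for x
      proof (rule ccontr)
        assume nz: "cinner x a \<noteq> 0"
        have "A x = - (cinner x a *\<^sub>C d)" using x by (simp add: ker_def A'_def F0_def eq_neg_iff_add_eq_0)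
        then have "A (- inverse (cinner x a) *\<^sub>C x) = d"
          using nz by (simp add: cvec_pair.linear_scale[OF lin] scaleC_scaleC cvec_pair.linear_neg[OF lin])
        then show False using d by blast
      qed
      then show "\<And>x. x \<in> ker A' \<Longrightarrow> cinner x a = 0" .
      then show "ker A' \<subseteq> ker A" by (fastforce simp: ker_def A'_def F0_def)
    qed
    have finA': "findim (ker A')" using findim_subset[OF A(3) kersub(1)] .
    have dimlt: "cvec.dim (ker A') < cvec.dim (ker A)"
    proof (rule ccontr)
      assume "\<not> ?thesis"
      then have "ker A' = ker A"
        using findim_subspace_eqI[OF subspace_ker[OF bounded_clinear_imp_clinear[OF A']] kersub(1) A(3)] by simp
      then have "cinner a a = 0" using kersub(2) a by blast
      then show False using a cinner_self_eq_0 by blast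
    qed
    have rangeA': "range A' = cvec.span (insert d (range A))"
    proof (intro set_eqI iffI)
      fix y assume "y \<in> range A'"
      then obtain x where "y = A x + cinner x a *\<^sub>C d" by (auto simp: A'_def F0_def)
      then have "y - cinner x a *\<^sub>C d \<in> cvec.span (range A)" by (simp add: spanR)
      then show "y \<in> cvec.span (insert d (range A))" unfolding cvec.span_insert by blast
    next
      fix y assume "y \<in> cvec.span (insert d (range A))"
      then obtain k x where x: "y - k *\<^sub>C d = A x" unfolding cvec.span_insert spanR by blast
      \<comment> \<open>Adding multiples of \<open>a\<close> leaves \<open>A x\<close> alone and
        changes the coefficient of \<open>d\<close> at will; this \<open>t\<close> makes it equal to
        \<open>k\<close>.\<close>
      define t where "t = (k - cinner x a) / cinner a a"
      have "cinner a a \<noteq> 0" using a cinner_self_eq_0 by blast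
      then have "cinner (x + t *\<^sub>C a) a = k" by (simp add: t_def cinner_add_left cinner_scaleC_left)
      moreover have "A (x + t *\<^sub>C a) = A x"
        using a by (simp add: ker_def cvec_pair.linear_add[OF lin] cvec_pair.linear_scale[OF lin])
      ultimately have "A' (x + t *\<^sub>C a) = A x + k *\<^sub>C d" by (simp add: A'_def F0_def)
      then have "A' (x + t *\<^sub>C a) = y" using x by (simp add: diff_eq_eq)
      then show "y \<in> range A'" by blast
    qed
    have "closed (range A')"
      unfolding rangeA' by (rule closed_span_insert[OF A(2) clinear_subspace_range[OF lin]])
    moreover have "nullity A' \<le> defect A'"
      unfolding defect_def ccodim_def
    proof (rule Inf_greatest, safe)
      fix D assume D: "finite D" "cvec.span (range A' \<union> D) = UNIV"
      \<comment> \<open>If \<open>D\<close> completes the range of \<open>A'\<close>, then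
        \<open>insert d D\<close> completes that of \<open>A\<close>. So
        \<open>dim (ker A) \<le> card D + 1\<close>, and the strict drop of the dimension absorbs
        the 1.\<close>
      have "range A' \<union> D \<subseteq> cvec.span (range A \<union> insert d D)"
      proof -
        have "cvec.span (insert d (range A)) \<subseteq> cvec.span (range A \<union> insert d D)"
          by (rule cvec.span_mono) auto
        then show ?thesis unfolding rangeA' by (auto intro: cvec.span_base)
      qed
      then have "cvec.span (range A' \<union> D) \<subseteq> cvec.span (range A \<union> insert d D)"
        by (intro cvec.span_minimal) auto
      then have U: "cvec.span (range A \<union> insert d D) = UNIV" using D(2) by blast
      have "defect A \<le> enat (card (insert d D))"
        unfolding defect_def ccodim_def
        by (rule Inf_lower, rule CollectI, rule exI[of _ "insert d D"]) (use U D(1) in simp)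
      then have "cvec.dim (ker A) \<le> card (insert d D)"
        using A(4) order_trans unfolding nullity_def cdim_findim[OF A(3)] by fastforce
      also have "\<dots> \<le> Suc (card D)" by (rule card_insert_le_m1[THEN le_trans]) (use D in auto)
      finally show "nullity A' \<le> enat (card D)" using dimlt
        unfolding nullity_def cdim_findim[OF finA'] by simp
    qed
    ultimately obtain F1 where F1: "bounded_clinear F1" "finite_rank F1" "bounded_below_op (\<lambda>x. A' x + F1 x)"
      using less.hyps[OF dimlt A'] finA' by blast
    have "(\<lambda>x. A' x + F1 x) = (\<lambda>x. A x + (F0 x + F1 x))" by (simp add: A'_def add.assoc)
    then show ?thesis
      using bounded_clinear_add[OF F0(1) F1(1)] finite_rank_add[OF F0(2) F1(2)] F1(3)
      by (intro exI[of _ "\<lambda>x. F0 x + F1 x"]) simp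
  qed
qed

text \<open>Any further finite rank term can be absorbed into \<open>F\<close>, which is the
  advantage over the index. For the converse, \<open>A = B + G\<close> with \<open>B\<close> bounded
  below has as its range the closed image of \<open>ker G\<close> under \<open>B\<close> plus
  finitely many vectors.\<close>

theorem upper_semi_weyl_iff:
  fixes A :: "'a::complex_hilbert_space \<Rightarrow> 'a"
  assumes A: "bounded_clinear A"
  shows "upper_semi_weyl A \<longleftrightarrow>
    (\<exists>F. bounded_clinear F \<and> finite_rank F \<and> bounded_below_op (\<lambda>x. A x + F x))"
proof
  assume "upper_semi_weyl A"
  then show "\<exists>F. bounded_clinear F \<and> finite_rank F \<and> bounded_below_op (\<lambda>x. A x + F x)"
    using upper_semi_weyl_imp_finite_rank_perturbation[OF A] upper_semi_weyl_alt by blast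
next
  assume "\<exists>F. bounded_clinear F \<and> finite_rank F \<and> bounded_below_op (\<lambda>x. A x + F x)"
  then obtain F where F: "bounded_clinear F" "finite_rank F" "bounded_below_op (\<lambda>x. A x + F x)" by blast
  define B where "B = (\<lambda>x. A x + F x)"
  define G where "G = (\<lambda>x. - F x)"
  have B: "bounded_clinear B" "bounded_below_op B"
    unfolding B_def using bounded_clinear_add[OF A F(1)] F(3) by auto
  have G: "bounded_clinear G" "finite_rank G"
    unfolding G_def using bounded_clinear_minus[OF F(1)] finite_rank_minus[OF F(2)] by auto
  have AB: "A = (\<lambda>x. B x + G x)" by (simp add: B_def G_def)
  have linB: "clinear B" "ker B = {0}" using bounded_clinear_imp_clinear B bounded_below_imp_ker by auto
  have linG: "clinear G" using bounded_clinear_imp_clinear G by auto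
  have "inj_on G (cvec.span {})" by simp
  then obtain E where E: "finite E" "cvec.span (ker G \<union> E) = UNIV"
    using finite_rank_ker_complement[OF linG G(2) cvec.independent_empty] by metis
  have "closed (B ` ker G)"
    by (rule bounded_below_closed_image[OF B(2,1) closed_ker[OF G(1)] subspace_ker[OF linG]])
  then have "closed (cvec.span (B ` ker G \<union> A ` E))"
    using E(1) by (intro closed_span_Un_finite cvec_pair.linear_subspace_image[OF linB(1)] subspace_ker[OF linG]) auto
  then have "closed (range A)"
    using finite_rank_perturbation_range[OF linB(1) linG E(2)] AB by simp
  moreover have "findim (ker A)" unfolding AB by (rule finite_rank_perturbation_ker(1)[OF linB linG G(2)])
  moreover have "nullity A \<le> defect A"
    unfolding AB by (rule finite_rank_perturbation_nullity_le_defect[OF linB linG G(2)])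
  ultimately show "upper_semi_weyl A" unfolding upper_semi_weyl_alt by blast
qed

corollary upper_semi_weyl_finite_rank_perturbation:
  fixes A :: "'a::complex_hilbert_space \<Rightarrow> 'a"
  assumes A: "bounded_clinear A" "upper_semi_weyl A" and K: "bounded_clinear K" "finite_rank K"
  shows "upper_semi_weyl (\<lambda>x. A x + K x)"
proof -
  obtain F where F: "bounded_clinear F" "finite_rank F" "bounded_below_op (\<lambda>x. A x + F x)"
    using upper_semi_weyl_iff A by blast
  have "(\<lambda>x. A x + F x) = (\<lambda>x. (A x + K x) + (- K x + F x))" by simp
  then have "bounded_below_op (\<lambda>x. (A x + K x) + (- K x + F x))" using F(3) by (simp only:)
  then show ?thesis
    unfolding upper_semi_weyl_iff[OF bounded_clinear_add[OF A(1) K(1)]]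
    using bounded_clinear_add[OF bounded_clinear_minus[OF K(1)] F(1)]
      finite_rank_add[OF finite_rank_minus[OF K(2)] F(2)]
    by (intro exI[of _ "\<lambda>x. - K x + F x"]) simp
qed

corollary bounded_below_imp_upper_semi_weyl:
  fixes A :: "'a::complex_hilbert_space \<Rightarrow> 'a"
  assumes "bounded_clinear A" "bounded_below_op A" shows "upper_semi_weyl A"
  unfolding upper_semi_weyl_iff[OF assms(1)]
  using assms(2) bounded_clinear_zero finite_rank_zero by (intro exI[of _ "\<lambda>x. 0"]) simp

text \<open>The operator \<open>C + F = C (I + C\<inverse> F)\<close> is governed by the restriction of \<open>I + C\<inverse> F\<close>
  to the finite-dimensional range of \<open>C\<inverse> F\<close>.\<close>

lemma invertible_plus_finite_rank_surj:
  fixes C F :: "'a::complex_hilbert_space \<Rightarrow> 'a"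
  assumes C: "op_invertible C" "bounded_clinear C" and F: "clinear F" "finite_rank F"
    and ker: "ker (\<lambda>x. C x + F x) = {0}"
  shows "range (\<lambda>x. C x + F x) = UNIV"
proof -
  obtain S where S: "bounded_clinear S" "S \<circ> C = id" "C \<circ> S = id" using C unfolding op_invertible_def by blast
  have CS: "C (S y) = y" for y using S(3) by (metis comp_apply id_apply)
  have linC: "clinear C" and linS: "clinear S" using bounded_clinear_imp_clinear C S by auto
  define G where "G = (\<lambda>x. S (F x))"
  have G: "clinear G" "finite_rank G"
    unfolding G_def using linS F finite_rank_compose_left[OF linS F(2)]
    by (auto intro!: clinearI simp: cvec_pair.linear_add cvec_pair.linear_scale)
  have CG: "C (x + G x) = C x + F x" for x by (simp add: G_def CS cvec_pair.linear_add[OF linC])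
  define V where "V = range G"
  have V: "findim V" "cvec.subspace V"
    unfolding V_def using G clinear_subspace_range by (auto simp: finite_rank_iff)
  have surj: "(\<lambda>x. x + G x) ` V = V"
  proof (rule findim_inj_imp_surj[OF _ V])
    show "clinear (\<lambda>x. x + G x)"
      using G(1) by (intro clinearI) (simp_all add: cvec_pair.linear_add cvec_pair.linear_scale scaleC_add_right)
    show "x = 0" if "x + G x = 0" for x
    proof -
      have "C x + F x = 0" using CG[of x] that cvec_pair.linear_0[OF linC] by simp
      then have "x \<in> ker (\<lambda>x. C x + F x)" by (simp add: ker_def)
      then show ?thesis using ker by simp
    qed
    show "(\<lambda>x. x + G x) ` V \<subseteq> V"
      using cvec.subspace_add[OF V(2)] by (simp add: V_def image_subset_iff)
  qed
  have "y \<in> range (\<lambda>x. C x + F x)" for y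
  proof -
    have "- G (S y) \<in> V" using cvec.subspace_neg[OF V(2)] by (simp add: V_def)
    then obtain r where r: "- G (S y) = r + G r" using surj by blast
    have "C (S y + r) + F (S y + r) = C (S y + r + G (S y + r))" by (rule CG[symmetric])
    also have "S y + r + G (S y + r) = S y + (G (S y) + (r + G r))"
      by (simp add: cvec_pair.linear_add[OF G(1)] algebra_simps)
    also have "\<dots> = S y" by (simp flip: r)
    also have "C (S y) = y" by (rule CS)
    finally show ?thesis by (rule range_eqI[OF sym])
  qed
  then show ?thesis by blast
qed

section \<open>Isolated points of the spectrum\<close>

lemma eventually_at_shift:
  "(\<forall>\<^sub>F \<mu> in at l. P (op_shift T \<mu>)) \<longleftrightarrow> (\<forall>\<^sub>F \<mu> in at 0. P (op_shift (op_shift T l) \<mu>))"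
proof -
  have "op_shift (op_shift T l) \<mu> = op_shift T (\<mu> + l)" for \<mu>
    by (simp add: op_shift_def scaleC_add_left algebra_simps)
  then show ?thesis
    by (subst at_to_0) (simp add: eventually_filtermap)
qed

lemma bounded_below_shift_near_0:
  fixes A :: "'a::complex_hilbert_space \<Rightarrow> 'a"
  assumes "bounded_below_op A"
  shows "\<forall>\<^sub>F \<mu> in at 0. bounded_below_op (op_shift A \<mu>)"
proof -
  obtain c where c: "c > 0" "\<And>x. c * norm x \<le> norm (A x)"
    using assms unfolding bounded_below_op_def by blast
  have "bounded_below_op (op_shift A \<mu>)" if "cmod \<mu> < c/2" for \<mu>
    unfolding bounded_below_op_def
  proof (intro exI[of _ "c/2"] conjI allI)
    fix x :: 'a
    have "cmod \<mu> * norm x \<le> c/2 * norm x" using that by (intro mult_right_mono) auto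
    moreover have "norm (A x) - cmod \<mu> * norm x \<le> norm (op_shift A \<mu> x)"
      using norm_triangle_ineq2[of "A x" "\<mu> *\<^sub>C x"] by (simp add: op_shift_def norm_scaleC)
    ultimately show "c/2 * norm x \<le> norm (op_shift A \<mu> x)" using c(2)[of x] by (simp add: field_simps)
  qed (use c in simp)
  then show ?thesis unfolding eventually_at using c(1) by (intro exI[of _ "c/2"]) auto
qed

text \<open>For small \<open>\<mu>\<close> the solutions of \<open>A x - \<mu> x = y\<close> are
  bounded by \<open>2 norm y / c\<close> independently of \<open>\<mu>\<close>, so
  \<open>A x\<close> comes arbitrarily close to \<open>y\<close>. The range is thus dense, and it is
  closed.\<close>

lemma bounded_below_limit_of_invertible:
  fixes A :: "'a::complex_hilbert_space \<Rightarrow> 'a"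
  assumes A: "bounded_clinear A" "bounded_below_op A"
    and ev: "\<forall>\<^sub>F \<mu> in at 0. op_invertible (op_shift A \<mu>)"
  shows "op_invertible A"
proof -
  obtain c where c: "c > 0" "\<And>x. c * norm x \<le> norm (A x)"
    using A unfolding bounded_below_op_def by blast
  have cl: "closed (range A)" "ker A = {0}" using A bounded_below_op_iff by blast+
  have "y \<in> closure (range A)" for y
    unfolding closure_approachable
  proof (intro allI impI)
    fix e :: real assume e: "e > 0"
    \<comment> \<open>The first bound keeps \<open>A - \<mu>\<close> bounded below by
      \<open>c / 2\<close>; the second pushes \<open>cmod \<mu> * (2 * norm y / c)\<close> under
      \<open>e\<close>, the added 1 keeping the denominator positive at
      \<open>y = 0\<close>.\<close>
    define d where "d = min (c/2) (e * c / (2 * (norm y + 1)))"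
    have ny: "norm y + 1 > 0" by (simp add: add_nonneg_pos)
    then have d: "d > 0" using c e by (simp add: d_def)
    have "\<forall>\<^sub>F \<mu> in at (0::complex). dist \<mu> 0 < d"
      unfolding eventually_at using d by (intro exI[of _ d]) auto
    then have "\<forall>\<^sub>F \<mu> in at 0. op_invertible (op_shift A \<mu>) \<and> dist \<mu> 0 < d"
      by (intro eventually_conj ev)
    then obtain \<mu> where \<mu>: "op_invertible (op_shift A \<mu>)" "cmod \<mu> < d"
      using eventually_happens[of _ "at (0::complex)"] by auto
    then have "y \<in> range (op_shift A \<mu>)"
      using op_invertible_iff[OF bounded_clinear_shift[OF A(1)], of \<mu>] by simp
    then obtain x where x: "y = A x - \<mu> *\<^sub>C x" by (auto simp: op_shift_def)
    have "norm (A x) - cmod \<mu> * norm x \<le> norm y"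
      using norm_triangle_ineq2[of "A x" "\<mu> *\<^sub>C x"] by (simp add: x norm_scaleC)
    moreover have "cmod \<mu> * norm x \<le> c/2 * norm x" using \<mu> by (intro mult_right_mono) (auto simp: d_def)
    ultimately have xy: "c/2 * norm x \<le> norm y" using c(2)[of x] by (simp add: field_simps)
    have "dist (A x) y = cmod \<mu> * norm x" by (simp add: x dist_norm norm_scaleC)
    also have "\<dots> \<le> cmod \<mu> * (2 * norm y / c)" using xy c(1) by (intro mult_left_mono) (auto simp: field_simps)
    also have "\<dots> \<le> e * c / (2 * (norm y + 1)) * (2 * norm y / c)"
      using \<mu> c(1) by (intro mult_right_mono) (auto simp: d_def)
    also have "\<dots> = e * (norm y / (norm y + 1))" using c(1) ny by (simp add: field_simps)
    also have "\<dots> < e * 1" using e ny by (intro mult_strict_left_mono) auto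
    finally have "dist (A x) y < e" by simp
    then show "\<exists>z\<in>range A. dist z y < e" by (rule bexI[OF _ rangeI])
  qed
  then have "range A = UNIV" unfolding closure_closed[OF cl(1)] by (rule UNIV_eq_I[symmetric])
  then show ?thesis using cl(2) op_invertible_iff[OF A(1)] by blast
qed

text \<open>A preimage \<open>x\<close> of \<open>y\<close> under \<open>A\<close> solves the
  shifted equation up to the error \<open>\<mu> x\<close>, of norm at most
  \<open>cmod \<mu> * C * norm y\<close>. When this is at most half of \<open>norm y\<close>, the
  iteration of \<open>exact_solution_from_approximate\<close> applies.\<close>

lemma shift_solvable_on_invariant:
  fixes A :: "'a::complex_hilbert_space \<Rightarrow> 'a"
  assumes A: "bounded_clinear A" and M: "closed M" "cvec.subspace M" "A ` M = M"
  shows "\<exists>C>0. \<forall>\<mu> y. cmod \<mu> * C \<le> 1/2 \<longrightarrow> y \<in> M \<longrightarrow>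
    (\<exists>x\<in>M. op_shift A \<mu> x = y \<and> norm x \<le> 2 * C * norm y)"
proof -
  have sub: "subspace M" by (rule cvec_subspace_imp_subspace[OF M(2)])
  obtain C where C: "C > 0" "\<forall>y\<in>A ` M. \<exists>x\<in>M. A x = y \<and> norm x \<le> C * norm y"
    using open_mapping_subspace[OF bounded_clinear_imp_bounded_linear[OF A] M(1) sub] M by auto
  have "\<exists>x\<in>M. op_shift A \<mu> x = y \<and> norm x \<le> 2 * C * norm y" if \<mu>: "cmod \<mu> * C \<le> 1/2" and y: "y \<in> M" for \<mu> y
  proof (rule exact_solution_from_approximate[OF _ M(1) sub sub _ _ _ y])
    show "bounded_linear (op_shift A \<mu>)"
      by (rule bounded_clinear_imp_bounded_linear[OF bounded_clinear_shift[OF A]])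
    show "op_shift A \<mu> ` M \<subseteq> M"
    proof (rule image_subsetI)
      fix x assume x: "x \<in> M"
      then have "A x \<in> M" using M(3) by (metis imageI)
      then show "op_shift A \<mu> x \<in> M"
        unfolding op_shift_def using x by (intro cvec.subspace_diff[OF M(2)] cvec.subspace_scale[OF M(2)])
    qed
    fix y assume "y \<in> M"
    then obtain x where x: "x \<in> M" "A x = y" "norm x \<le> C * norm y" using C(2) M(3) by blast
    have "norm (y - op_shift A \<mu> x) = cmod \<mu> * norm x" using x by (simp add: op_shift_def norm_scaleC)
    also have "\<dots> \<le> cmod \<mu> * (C * norm y)" using x by (intro mult_left_mono) auto
    also have "\<dots> = (cmod \<mu> * C) * norm y" by simp
    also have "\<dots> \<le> 1/2 * norm y" using \<mu> by (rule mult_right_mono) simp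
    finally have "norm (y - op_shift A \<mu> x) \<le> norm y / 2" by simp
    then show "\<exists>x\<in>M. norm x \<le> C * norm y \<and> norm (y - op_shift A \<mu> x) \<le> norm y / 2" using x by blast
  qed (use C in simp)
  then show ?thesis using C(1) by blast
qed

lemma eventually_cmod_less: "r > 0 \<Longrightarrow> \<forall>\<^sub>F \<mu> in at (0::complex). cmod \<mu> < r"
  unfolding eventually_at by (intro exI[of _ r]) auto

text \<open>If \<open>A x\<^sub>0 = 0\<close> and \<open>(A - \<mu>) z = x\<^sub>0\<close>, then \<open>x\<^sub>0 + \<mu> z\<close> is an eigenvector for \<open>\<mu>\<close>.\<close>

lemma ker_shift_nontrivial_near_0:
  fixes A :: "'a::complex_hilbert_space \<Rightarrow> 'a"
  assumes A: "bounded_clinear A" and M: "closed M" "cvec.subspace M" "A ` M = M"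
    and x0: "x0 \<in> M" "A x0 = 0" "x0 \<noteq> 0"
  shows "\<forall>\<^sub>F \<mu> in at 0. ker (op_shift A \<mu>) \<noteq> {0}"
proof -
  have lin: "clinear A" using bounded_clinear_imp_clinear[OF A] .
  obtain C where C: "C > 0" "\<And>\<mu> y. cmod \<mu> * C \<le> 1/2 \<Longrightarrow> y \<in> M \<Longrightarrow>
    \<exists>x\<in>M. op_shift A \<mu> x = y \<and> norm x \<le> 2 * C * norm y"
    using shift_solvable_on_invariant[OF A M] by blast
  have "ker (op_shift A \<mu>) \<noteq> {0}" if "cmod \<mu> < 1 / (2 * C)" for \<mu>
  proof -
    \<comment> \<open>Strictness gives \<open>\<mu> z\<close> a smaller norm than \<open>x0\<close>,
      so that \<open>x0 + \<mu> z\<close> is nonzero.\<close>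
    have \<mu>: "cmod \<mu> * (2 * C) < 1" using that C(1) by (simp add: field_simps)
    then obtain z where z: "op_shift A \<mu> z = x0" "norm z \<le> 2 * C * norm x0"
      using C(2)[of \<mu> x0] x0(1) by auto
    define x where "x = x0 + \<mu> *\<^sub>C z"
    have "op_shift A \<mu> x = A x0 + \<mu> *\<^sub>C (op_shift A \<mu> z - x0)"
      by (simp add: x_def op_shift_def cvec_pair.linear_add[OF lin] cvec_pair.linear_scale[OF lin]
          scaleC_add_right cvec.scale_right_diff_distrib)
    then have "x \<in> ker (op_shift A \<mu>)" by (simp add: ker_def z x0)
    moreover have "x \<noteq> 0"
    proof
      assume "x = 0"
      then have "norm x0 = norm (\<mu> *\<^sub>C z)" by (metis x_def add_eq_0_iff norm_minus_cancel)
      also have "\<dots> \<le> cmod \<mu> * (2 * C * norm x0)" using z by (simp add: norm_scaleC mult_left_mono)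
      also have "\<dots> = (cmod \<mu> * (2 * C)) * norm x0" by simp
      also have "\<dots> < 1 * norm x0" using \<mu> x0 by (intro mult_strict_right_mono) auto
      finally show False by simp
    qed
    ultimately show ?thesis by blast
  qed
  then show ?thesis
    using eventually_mono[OF eventually_cmod_less[of "1 / (2 * C)"]] C(1) by simp
qed

section \<open>The hyperrange and the kernels of powers\<close>

definition hyperrange :: "('a \<Rightarrow> 'a) \<Rightarrow> 'a set" where
  "hyperrange A = (\<Inter>n. range (A ^^ n))"

lemma range_funpow_antimono:
  fixes A :: "'a \<Rightarrow> 'a"
  assumes "m \<le> n" shows "range (A ^^ n) \<subseteq> range (A ^^ m)"
proof -
  have "A ^^ n = A ^^ m \<circ> A ^^ (n - m)" using assms by (simp flip: funpow_add)
  then show ?thesis by auto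
qed

text \<open>A decreasing chain of subspaces of a finite-dimensional space; \<open>k\<close> is an
  index of least dimension.\<close>

lemma ker_range_stabilise:
  fixes A :: "'a::complex_hilbert_space \<Rightarrow> 'a"
  assumes A: "bounded_clinear A" "findim (ker A)"
  obtains k where "\<And>n. n \<ge> k \<Longrightarrow> ker A \<inter> range (A ^^ n) = ker A \<inter> range (A ^^ k)"
proof -
  define D where "D n = ker A \<inter> range (A ^^ n)" for n
  have sub: "cvec.subspace (D n)" for n
    unfolding D_def by (intro cvec.subspace_inter subspace_ker clinear_subspace_range
        bounded_clinear_imp_clinear bounded_clinear_funpow A(1))
  have fin: "findim (D n)" for n using findim_subset[OF A(2)] by (simp add: D_def)
  obtain k where k: "\<And>n. cvec.dim (D k) \<le> cvec.dim (D n)"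
    using ex_has_least_nat[of "\<lambda>_. True" 0 "\<lambda>n. cvec.dim (D n)"] by blast
  have "D n = D k" if "n \<ge> k" for n
  proof (rule findim_subspace_eqI[OF sub _ fin k])
    show "D n \<subseteq> D k" unfolding D_def by (intro Int_mono subset_refl range_funpow_antimono that)
  qed
  then show ?thesis using that unfolding D_def by blast
qed

text \<open>The obstacle is that a preimage of \<open>x\<close> in \<open>range (A ^^ n)\<close> may
  depend on \<open>n\<close>. Beyond the stabilisation index \<open>k\<close>, two of them differ by
  a vector of \<open>ker A\<close> in \<open>range (A ^^ k)\<close>, hence in
  \<open>range (A ^^ n)\<close>, so one preimage from \<open>range (A ^^ k)\<close> serves for all
  \<open>n\<close>.\<close>

lemma image_hyperrange:
  fixes A :: "'a::complex_hilbert_space \<Rightarrow> 'a"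
  assumes A: "bounded_clinear A" "findim (ker A)"
  shows "A ` hyperrange A = hyperrange A"
proof
  have lin: "clinear A" using bounded_clinear_imp_clinear[OF A(1)] .
  show "A ` hyperrange A \<subseteq> hyperrange A"
  proof (rule image_subsetI)
    fix x assume "x \<in> hyperrange A"
    then have "A x \<in> range (A ^^ Suc n)" for n unfolding range_funpow_Suc by (simp add: hyperrange_def)
    then have "A x \<in> range (A ^^ n)" for n by (rule subsetD[OF range_funpow_antimono[of n "Suc n"], rotated]) simp
    then show "A x \<in> hyperrange A" by (simp add: hyperrange_def)
  qed
  obtain k where k: "\<And>n. n \<ge> k \<Longrightarrow> ker A \<inter> range (A ^^ n) = ker A \<inter> range (A ^^ k)"
    using ker_range_stabilise[OF A] by blast
  show "hyperrange A \<subseteq> A ` hyperrange A"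
  proof
    fix x assume x: "x \<in> hyperrange A"
    have pre: "\<exists>y\<in>range (A ^^ n). A y = x" for n
    proof -
      have "x \<in> range (A ^^ Suc n)" using x by (simp only: hyperrange_def INT_iff UNIV_I)
      then show ?thesis unfolding range_funpow_Suc by (metis imageE)
    qed
    obtain y where y: "y \<in> range (A ^^ k)" "A y = x" using pre[of k] by (elim bexE)
    have "y \<in> range (A ^^ n)" for n
    proof (cases "n \<ge> k")
      case True
      obtain y' where y': "y' \<in> range (A ^^ n)" "A y' = x" using pre[of n] by (elim bexE)
      have sub: "cvec.subspace (range (A ^^ m))" for m
        by (intro clinear_subspace_range bounded_clinear_imp_clinear bounded_clinear_funpow A(1))
      have "y' \<in> range (A ^^ k)" by (rule subsetD[OF range_funpow_antimono[OF True] y'(1)])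
      then have "y - y' \<in> range (A ^^ k)" by (rule cvec.subspace_diff[OF sub y(1)])
      moreover have "y - y' \<in> ker A" by (simp add: ker_def cvec_pair.linear_diff[OF lin] y y')
      ultimately have "y - y' \<in> ker A \<inter> range (A ^^ k)" by (intro IntI)
      then have "y - y' \<in> range (A ^^ n)" unfolding k[OF True, symmetric] by (rule IntD2)
      then have "(y - y') + y' \<in> range (A ^^ n)" by (rule cvec.subspace_add[OF sub _ y'(1)])
      then show ?thesis by simp
    next
      case False
      then show ?thesis using range_funpow_antimono[of n k A] y by auto
    qed
    then show "x \<in> A ` hyperrange A" using y(2) by (auto simp: hyperrange_def)
  qed
qed

text \<open>All powers have closed range, so the hyperrange is closed and the open mapping theorem
  applies on it. The result bounds the ascent at an isolated point and later rules out nonzero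
  kernels contained in the hyperrange.\<close>

lemma ker_Int_hyperrange_trivial:
  fixes A :: "'a::complex_hilbert_space \<Rightarrow> 'a"
  assumes A: "bounded_clinear A" "closed (range A)" "findim (ker A)"
    and ev: "\<forall>\<^sub>F \<mu> in at 0. ker (op_shift A \<mu>) = {0}"
  shows "ker A \<inter> hyperrange A = {0}"
proof -
  have "closed (hyperrange A)" unfolding hyperrange_def using closed_range_funpow[OF A] by blast
  moreover have sub: "cvec.subspace (hyperrange A)"
    unfolding hyperrange_def by (intro cvec.subspace_Int clinear_subspace_range
        bounded_clinear_imp_clinear bounded_clinear_funpow A(1))
  moreover note image_hyperrange[OF A(1,3)]
  ultimately have "\<forall>\<^sub>F \<mu> in at 0. ker (op_shift A \<mu>) \<noteq> {0}" if "x \<in> hyperrange A" "A x = 0" "x \<noteq> 0" for x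
    using ker_shift_nontrivial_near_0[OF A(1) _ _ _ that] by blast
  then have "\<forall>\<^sub>F \<mu> in at (0::complex). False" if "x \<in> hyperrange A" "A x = 0" "x \<noteq> 0" for x
    using eventually_conj[OF ev] that by (fastforce elim: eventually_mono)
  then have "x = 0" if "x \<in> hyperrange A" "A x = 0" for x
    using that by (auto simp: trivial_limit_def[symmetric])
  moreover have "0 \<in> hyperrange A" using cvec.subspace_0[OF sub] .
  moreover have "A 0 = 0" using cvec_pair.linear_0[OF bounded_clinear_imp_clinear[OF A(1)]] .
  ultimately show ?thesis unfolding ker_def by blast
qed

text \<open>If \<open>(A ^^ Suc n) x = 0\<close> with \<open>n \<ge> k\<close>, then
  \<open>(A ^^ n) x\<close> lies in \<open>ker A\<close> and in \<open>range (A ^^ k)\<close>, hence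
  is 0.\<close>

lemma ker_funpow_stable:
  assumes "ker A \<inter> range (A ^^ k) = {0}"
  shows "n \<ge> k \<Longrightarrow> ker (A ^^ n) = ker (A ^^ k)"
proof (induction n rule: dec_induct)
  case (step n)
  have "ker (A ^^ Suc n) \<subseteq> ker (A ^^ n)"
  proof
    fix x assume "x \<in> ker (A ^^ Suc n)"
    then have "(A ^^ n) x \<in> ker A" by (simp add: ker_def)
    moreover have "(A ^^ n) x \<in> range (A ^^ k)" by (rule subsetD[OF range_funpow_antimono[OF step(1)] rangeI])
    ultimately have "(A ^^ n) x \<in> {0}" unfolding assms[symmetric] by (rule IntI)
    then have "(A ^^ n) x = 0" by simp
    then show "x \<in> ker (A ^^ n)" by (simp add: ker_def)
  qed
  moreover have "ker (A ^^ n) \<subseteq> ker (A ^^ Suc n)"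
  proof
    fix x assume "x \<in> ker (A ^^ n)"
    moreover have "A 0 = 0" using assms by (auto simp: ker_def)
    ultimately show "x \<in> ker (A ^^ Suc n)" by (simp add: ker_def)
  qed
  ultimately show ?case using step.IH by blast
qed simp

text \<open>Every term of the expanded power other than \<open>B ^^ n\<close> contains a factor
  \<open>F\<close>. Thus powers of an invertible operator plus finite rank keep that shape.\<close>

lemma finite_rank_funpow_perturbation:
  assumes B: "clinear B" and F: "clinear F" "finite_rank F"
  shows "\<exists>G. clinear G \<and> finite_rank G \<and> (\<forall>x. ((\<lambda>x. B x + F x) ^^ n) x = (B ^^ n) x + G x)"
proof (induction n)
  case 0
  show ?case using bounded_clinear_imp_clinear[OF bounded_clinear_zero] finite_rank_zero
    by (intro exI[of _ "\<lambda>x. 0"]) simp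
next
  case (Suc n)
  then obtain G where G: "clinear G" "finite_rank G"
    "\<And>x. ((\<lambda>x. B x + F x) ^^ n) x = (B ^^ n) x + G x" by blast
  have lB: "clinear (B ^^ n)"
    by (induction n) (auto intro!: clinearI simp: cvec_pair.linear_add[OF B] cvec_pair.linear_scale[OF B]
        cvec_pair.linear_add cvec_pair.linear_scale)
  define G' where "G' = (\<lambda>x. B (G x) + F ((B ^^ n) x + G x))"
  have "clinear G'"
    unfolding G'_def using B F(1) G(1) lB
    by (intro clinearI) (simp_all add: cvec_pair.linear_add cvec_pair.linear_scale scaleC_add_right)
  moreover have "finite_rank G'"
    unfolding G'_def by (intro finite_rank_add finite_rank_compose_left[OF B G(2)] finite_rank_compose_right[OF F(2)])
  moreover have "((\<lambda>x. B x + F x) ^^ Suc n) x = (B ^^ Suc n) x + G' x" for x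
    by (simp add: G(3) G'_def cvec_pair.linear_add[OF B] add.assoc)
  ultimately show ?case by blast
qed

text \<open>\<open>P\<close> is the Gram-type sum of \<open>cinner x b *\<^sub>C b\<close> over a
  basis of \<open>N\<close>. By independence, \<open>P x = 0\<close> makes \<open>x\<close>
  orthogonal to the basis, and a vector of \<open>N\<close> is then orthogonal to itself.\<close>

lemma finite_rank_operator_injective_on:
  fixes N :: "'a::complex_hilbert_space set"
  assumes N: "findim N" "cvec.subspace N"
  obtains P where "bounded_clinear P" "finite_rank P" "range P \<subseteq> N" "\<And>x. x \<in> N \<Longrightarrow> P x = 0 \<Longrightarrow> x = 0"
proof -
  obtain B where B: "finite B" "cvec.independent B" "B \<subseteq> N" "cvec.span B = N"
    using findim_basis[OF N] by metis
  define P where "P x = (\<Sum>b\<in>B. cinner x b *\<^sub>C b)" for x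
  have "bounded_clinear (\<lambda>x. \<Sum>b\<in>B. cinner x b *\<^sub>C b)"
    using B(1)
  proof (induction B rule: finite_induct)
    case (insert b B)
    then show ?case using bounded_clinear_add[OF bounded_clinear_cinner_scaleC insert.IH] by simp
  qed (simp add: bounded_clinear_zero)
  then have P: "bounded_clinear P" by (simp add: P_def[abs_def])
  have PN: "P x \<in> N" for x
    unfolding P_def using B(3) N(2) by (intro cvec.subspace_sum cvec.subspace_scale) auto
  have "x = 0" if x: "x \<in> N" "P x = 0" for x
  proof -
    have ort: "cinner x b = 0" if "b \<in> B" for b
      using cvec.independentD[OF B(2,1) subset_refl, of "cinner x" b] that x(2) by (simp add: P_def)
    have "cinner x y = 0" if "y \<in> cvec.span B" for y
      using that
    proof (induction rule: cvec.span_induct_alt)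
      case base
      then show ?case using cinner_scaleC_right[of x 0 x] by simp
    next
      case (step c b y)
      then show ?case using ort[of b]
        by (metis add.right_neutral cinner_add_left cinner_commute cinner_scaleC_left complex_cnj_zero_iff mult_zero_right)
    qed
    then show ?thesis using x B(4) cinner_self_eq_0 by blast
  qed
  moreover have "finite_rank P" unfolding finite_rank_iff using PN findim_subset[OF N(1)] by blast
  ultimately show ?thesis using that P PN by blast
qed

text \<open>The descent is finite because \<open>C = A\<^sup>k\<close> is again an invertible operator plus one of finite rank,
  and \<open>ker C \<inter> range C = {0}\<close>: adding to \<open>C\<close> a finite rank operator \<open>P\<close> with values in \<open>ker C\<close> that is
  injective there gives an injective, hence surjective operator, so \<open>range C + ker C\<close> is everything.\<close>

theorem isolated_upper_semi_weyl_imp_browder: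
  fixes A :: "'a::complex_hilbert_space \<Rightarrow> 'a"
  assumes A: "bounded_clinear A" "upper_semi_weyl A"
    and ev: "\<forall>\<^sub>F \<mu> in at 0. op_invertible (op_shift A \<mu>)"
  shows "browder A"
proof -
  have lin: "clinear A" using bounded_clinear_imp_clinear[OF A(1)] .
  have A': "closed (range A)" "findim (ker A)" using A(2) upper_semi_weyl_alt by blast+
  obtain F where F: "bounded_clinear F" "finite_rank F" "bounded_below_op (\<lambda>x. A x + F x)"
    using upper_semi_weyl_iff A by blast
  define B where "B = (\<lambda>x. A x + F x)"
  have B: "bounded_clinear B" "bounded_below_op B"
    unfolding B_def using bounded_clinear_add[OF A(1) F(1)] F(3) by auto
  \<comment> \<open>For nearby \<open>\<mu>\<close> the operator \<open>B - \<mu>\<close> is the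
    invertible \<open>A - \<mu>\<close> plus \<open>F\<close>, and it is injective because
    \<open>B\<close> is bounded below; hence it is invertible, and so is the limit
    \<open>B\<close>.\<close>
  have "\<forall>\<^sub>F \<mu> in at 0. op_invertible (op_shift B \<mu>)"
    using ev bounded_below_shift_near_0[OF B(2)]
  proof eventually_elim
    case (elim \<mu>)
    have sh: "op_shift B \<mu> = (\<lambda>x. op_shift A \<mu> x + F x)" by (auto simp: op_shift_def B_def)
    have "ker (op_shift B \<mu>) = {0}" using elim(2) bounded_below_imp_ker bounded_clinear_shift[OF B(1)] by blast
    then have "range (op_shift B \<mu>) = UNIV"
      unfolding sh using invertible_plus_finite_rank_surj[OF elim(1) bounded_clinear_shift[OF A(1)]
          bounded_clinear_imp_clinear[OF F(1)] F(2)] by blast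
    then show ?case
      using op_invertible_iff[OF bounded_clinear_shift[OF B(1)]] \<open>ker (op_shift B \<mu>) = {0}\<close> by blast
  qed
  then have invB: "op_invertible B" by (rule bounded_below_limit_of_invertible[OF B])
  then have rangeB: "ker B = {0}" "range B = UNIV" using op_invertible_iff[OF B(1)] by auto
  have linB: "clinear B" using bounded_clinear_imp_clinear[OF B(1)] .
  have "clinear (\<lambda>x. - F x)" "finite_rank (\<lambda>x. - F x)"
    using bounded_clinear_imp_clinear[OF bounded_clinear_minus[OF F(1)]] finite_rank_minus[OF F(2)] .
  moreover have AB: "A = (\<lambda>x. B x + - F x)" by (simp add: B_def)
  ultimately have pow: "\<exists>G. clinear G \<and> finite_rank G \<and> (\<forall>x. (A ^^ n) x = (B ^^ n) x + G x)" for n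
    using finite_rank_funpow_perturbation[OF linB] by metis
  have "\<forall>\<^sub>F \<mu> in at 0. ker (op_shift A \<mu>) = {0}"
    using ev by eventually_elim (simp add: op_invertible_iff[OF bounded_clinear_shift[OF A(1)]])
  then have hyp: "ker A \<inter> hyperrange A = {0}" by (rule ker_Int_hyperrange_trivial[OF A(1) A'])
  obtain k where k: "\<And>n. n \<ge> k \<Longrightarrow> ker A \<inter> range (A ^^ n) = ker A \<inter> range (A ^^ k)"
    using ker_range_stabilise[OF A(1) A'(2)] by blast
  \<comment> \<open>Beyond \<open>k\<close> the intersections no longer shrink, so the triviality
    known for the hyperrange is already reached at stage \<open>k\<close>.\<close>
  have "ker A \<inter> range (A ^^ k) \<subseteq> ker A \<inter> hyperrange A"
  proof
    fix x assume x: "x \<in> ker A \<inter> range (A ^^ k)"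
    have "x \<in> range (A ^^ n)" for n
      using x k[of n] range_funpow_antimono[of n k A] by (cases "n \<ge> k") auto
    then show "x \<in> ker A \<inter> hyperrange A" using x by (simp add: hyperrange_def)
  qed
  moreover have "0 \<in> ker A \<inter> range (A ^^ k)"
    using cvec.subspace_0[OF subspace_ker[OF lin]]
      cvec.subspace_0[OF clinear_subspace_range[OF bounded_clinear_imp_clinear[OF bounded_clinear_funpow[OF A(1)]]]]
    by blast
  ultimately have kA: "ker A \<inter> range (A ^^ k) = {0}" using hyp by blast
  have kerst: "ker (A ^^ n) = ker (A ^^ k)" if "n \<ge> k" for n using ker_funpow_stable[OF kA that] .
  have asc: "ascent A < \<infinity>"
  proof -
    have "ker (A ^^ k) = ker (A ^^ Suc k)" using kerst[of "Suc k"] by simp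
    then have "ascent A \<le> enat k" unfolding ascent_def by (intro Inf_lower) blast
    then show ?thesis using order.strict_trans1 enat_ord_simps(4) by blast
  qed
  define C where "C = A ^^ k"
  have C: "bounded_clinear C" unfolding C_def by (rule bounded_clinear_funpow[OF A(1)])
  have linC: "clinear C" using bounded_clinear_imp_clinear[OF C] .
  have CC: "C (C x) = (A ^^ (k + k)) x" for x by (simp add: C_def funpow_add)
  have kerCC: "C x = 0" if "C (C x) = 0" for x
  proof -
    have "x \<in> ker (A ^^ (k + k))" using that unfolding CC ker_def by (rule CollectI)
    then have "x \<in> ker C" using kerst[of "k + k"] by (simp add: C_def)
    then show ?thesis unfolding ker_def by (rule CollectD)
  qed
  obtain G where G: "clinear G" "finite_rank G" "\<And>x. C x = (B ^^ k) x + G x"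
    using pow[of k] unfolding C_def by blast
  have Bk: "bounded_clinear (B ^^ k)" by (rule bounded_clinear_funpow[OF B(1)])
  have invBk: "op_invertible (B ^^ k)"
  proof -
    have "bij B" using rangeB ker_inj[OF linB rangeB(1)] by (auto simp: bij_def inj_def)
    then have "bij (B ^^ k)" by (rule bij_fn)
    moreover have "(B ^^ k) 0 = 0" by (rule cvec_pair.linear_0[OF bounded_clinear_imp_clinear[OF Bk]])
    ultimately have "ker (B ^^ k) = {0}" unfolding ker_def bij_def inj_def by force
    then show ?thesis using \<open>bij (B ^^ k)\<close> by (simp add: op_invertible_iff[OF Bk] bij_def)
  qed
  have finC: "findim (ker C)"
  proof -
    have "ker (B ^^ k) = {0}" using invBk op_invertible_iff[OF Bk] by blast
    then have "findim (ker (\<lambda>x. (B ^^ k) x + G x))"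
      by (rule finite_rank_perturbation_ker(1)[OF bounded_clinear_imp_clinear[OF Bk] _ G(1,2)])
    then show ?thesis by (simp flip: G(3))
  qed
  obtain P where P: "bounded_clinear P" "finite_rank P" "range P \<subseteq> ker C"
    "\<And>x. x \<in> ker C \<Longrightarrow> P x = 0 \<Longrightarrow> x = 0"
    using finite_rank_operator_injective_on[OF finC subspace_ker[OF linC]] by blast
  have CP: "C (P x) = 0" for x using P(3) by (auto simp: ker_def)
  have linP: "clinear P" using bounded_clinear_imp_clinear[OF P(1)] .
  have sumeq: "C x + P x = (B ^^ k) x + (G x + P x)" for x by (simp add: G(3))
  have surj: "range (\<lambda>x. C x + P x) = UNIV"
    unfolding sumeq
  proof (rule invertible_plus_finite_rank_surj[OF invBk Bk])
    show "clinear (\<lambda>x. G x + P x)"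
      using G(1) linP by (intro clinearI) (simp_all add: cvec_pair.linear_add cvec_pair.linear_scale scaleC_add_right)
    show "finite_rank (\<lambda>x. G x + P x)" by (rule finite_rank_add[OF G(2) P(2)])
    have "x = 0" if x: "C x + P x = 0" for x
    proof -
      have "C (C x) + C (P x) = C 0" using x by (simp flip: cvec_pair.linear_add[OF linC])
      then have "C (C x) = 0" using CP cvec_pair.linear_0[OF linC] by simp
      then have "C x = 0" by (rule kerCC)
      then show ?thesis using x P(4)[of x] by (simp add: ker_def)
    qed
    moreover have "C 0 + P 0 = 0" using cvec_pair.linear_0[OF linC] cvec_pair.linear_0[OF linP] by simp
    ultimately show "ker (\<lambda>x. (B ^^ k) x + (G x + P x)) = {0}" unfolding ker_def sumeq[symmetric] by blast
  qed
  have rangeCC: "C y \<in> range (A ^^ (k + k))" for y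
  proof -
    have "y \<in> range (\<lambda>x. C x + P x)" unfolding surj by (rule UNIV_I)
    then obtain x where x: "y = C x + P x" by (rule rangeE)
    have "C y = C (C x)" by (simp add: x cvec_pair.linear_add[OF linC] CP)
    then show ?thesis unfolding CC by simp
  qed
  have desc: "descent A < \<infinity>"
  \<comment> \<open>For \<open>k = 0\<close> the inequality \<open>Suc k \<le> k + k\<close> fails.
    In that case \<open>A\<close> is injective, so bounded below, so invertible as a limit of
    invertible operators.\<close>
  proof (cases "k = 0")
    case True
    have "range A = UNIV"
    proof -
      have "ker A = {0}" using kA True by simp
      then have "bounded_below_op A" using A'(1) bounded_below_op_iff[OF A(1)] by blast
      then have "op_invertible A" by (rule bounded_below_limit_of_invertible[OF A(1) _ ev])
      then show ?thesis using op_invertible_iff[OF A(1)] by simp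
    qed
    then have "descent A \<le> enat 0" unfolding descent_def by (intro Inf_lower CollectI exI[of _ 0]) simp
    then show ?thesis using order.strict_trans1 enat_ord_simps(4) by blast
  next
    case False
    then have "range (A ^^ (k + k)) \<subseteq> range (A ^^ Suc k)" by (intro range_funpow_antimono) simp
    then have "range (A ^^ k) \<subseteq> range (A ^^ Suc k)" using rangeCC unfolding C_def by (intro image_subsetI) (rule subsetD)
    moreover have "range (A ^^ Suc k) \<subseteq> range (A ^^ k)" by (intro range_funpow_antimono) simp
    ultimately have "range (A ^^ k) = range (A ^^ Suc k)" by (rule equalityI)
    then have "descent A \<le> enat k" unfolding descent_def by (intro Inf_lower) blast
    then show ?thesis using order.strict_trans1 enat_ord_simps(4) by blast
  qed
  \<comment> \<open>Finite defect: \<open>B\<close> is onto and agrees with \<open>A\<close> on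
    \<open>ker F\<close>, so the image under \<open>B\<close> of a finite complement
    \<open>E\<close> of \<open>ker F\<close> completes the range of \<open>A\<close>.\<close>
  have "inj_on F (cvec.span {})" by simp
  then obtain E where E: "finite E" "cvec.span (ker F \<union> E) = UNIV"
    using finite_rank_ker_complement[OF bounded_clinear_imp_clinear[OF F(1)] F(2) cvec.independent_empty] by metis
  have "B ` (ker F \<union> E) \<subseteq> range A \<union> B ` E" by (auto simp: B_def ker_def)
  then have "cvec.span (B ` (ker F \<union> E)) \<subseteq> cvec.span (range A \<union> B ` E)" by (rule cvec.span_mono)
  moreover have "cvec.span (B ` (ker F \<union> E)) = UNIV"
    using cvec_pair.linear_span_image[OF linB] E(2) rangeB(2) by metis
  ultimately have U: "cvec.span (range A \<union> B ` E) = UNIV" by (simp only: top.extremum_unique)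
  then have "defect A \<le> enat (card (B ` E))"
    unfolding defect_def ccodim_def using E(1) U
    by (intro Inf_lower CollectI exI[of _ "B ` E"] conjI refl finite_imageI)
  then have "defect A < \<infinity>" using order.strict_trans1 enat_ord_simps(4) by blast
  moreover have "nullity A < \<infinity>" using A'(2) unfolding nullity_def cdim_less_infinity_iff .
  ultimately show ?thesis
    unfolding browder_def fredholm_def upper_semi_fredholm_def lower_semi_fredholm_def
    using A'(1) asc desc by blast
qed

section \<open>Browder operators\<close>

lemma ker_funpow_stationary:
  assumes eq: "ker (A ^^ p) = ker (A ^^ Suc p)"
  shows "n \<ge> p \<Longrightarrow> ker (A ^^ n) = ker (A ^^ p)"
proof (induction n rule: dec_induct)
  case (step n)
  have n: "(A ^^ n) x = (A ^^ p) ((A ^^ (n - p)) x)" for x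
    using step(1) by (simp flip: funpow_add[THEN fun_cong, unfolded comp_apply])
  have "x \<in> ker (A ^^ Suc n) \<longleftrightarrow> (A ^^ (n - p)) x \<in> ker (A ^^ Suc p)" for x
    by (simp add: ker_def n)
  moreover have "x \<in> ker (A ^^ n) \<longleftrightarrow> (A ^^ (n - p)) x \<in> ker (A ^^ p)" for x
    by (simp add: ker_def n)
  ultimately have "ker (A ^^ Suc n) = ker (A ^^ n)" using eq by blast
  then show ?case using step.IH by (rule trans)
qed simp

lemma range_funpow_stationary:
  fixes A :: "'a \<Rightarrow> 'a"
  assumes eq: "range (A ^^ q) = range (A ^^ Suc q)"
  shows "n \<ge> q \<Longrightarrow> range (A ^^ n) = range (A ^^ q)"
proof (induction n rule: dec_induct)
  case (step n)
  have "range (A ^^ Suc n) = A ` range (A ^^ n)" by (rule range_funpow_Suc)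
  also have "\<dots> = A ` range (A ^^ q)" by (simp only: step.IH)
  also have "\<dots> = range (A ^^ Suc q)" by (rule range_funpow_Suc[symmetric])
  also have "\<dots> = range (A ^^ q)" by (rule eq[symmetric])
  finally show ?case .
qed simp

text \<open>Once kernels and ranges of the powers are stationary, the space is the sum of
  \<open>range (A ^^ n)\<close>, where \<open>A\<close> is bijective, and
  \<open>ker (A ^^ n)\<close>, where it is nilpotent. The last conclusion is the sum.\<close>

lemma browder_splitting:
  fixes A :: "'a::complex_hilbert_space \<Rightarrow> 'a"
  assumes A: "bounded_clinear A" "browder A"
  obtains n where "closed (range (A ^^ n))" "A ` range (A ^^ n) = range (A ^^ n)"
    "ker A \<inter> range (A ^^ n) = {0}" "\<forall>x. \<exists>w. x - (A ^^ n) w \<in> ker (A ^^ n)"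
proof -
  have lin: "clinear A" using bounded_clinear_imp_clinear[OF A(1)] .
  have F: "closed (range A)" "findim (ker A)"
    using A(2) unfolding browder_def fredholm_def upper_semi_fredholm_def nullity_def cdim_less_infinity_iff by blast+
  obtain p where p: "ker (A ^^ p) = ker (A ^^ Suc p)"
    using A(2) unfolding browder_def ascent_def Inf_less_iff by blast
  obtain q where q: "range (A ^^ q) = range (A ^^ Suc q)"
    using A(2) unfolding browder_def descent_def Inf_less_iff by blast
  define n where "n = max p q"
  have K: "ker (A ^^ m) = ker (A ^^ n)" if "m \<ge> n" for m
    using ker_funpow_stationary[OF p, of m] ker_funpow_stationary[OF p, of n] that by (simp add: n_def)
  have R: "range (A ^^ m) = range (A ^^ n)" if "m \<ge> n" for m
    using range_funpow_stationary[OF q, of m] range_funpow_stationary[OF q, of n] that by (simp add: n_def)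
  have lin_n: "clinear (A ^^ m)" for m using bounded_clinear_imp_clinear[OF bounded_clinear_funpow[OF A(1)]] .
  show ?thesis
  proof (rule that)
    show "closed (range (A ^^ n))" by (rule closed_range_funpow[OF A(1) F])
    show "A ` range (A ^^ n) = range (A ^^ n)" using R[of "Suc n"] unfolding range_funpow_Suc by simp
    have "x = 0" if x: "x \<in> ker A" "x \<in> range (A ^^ n)" for x
    proof -
      obtain w where w: "x = (A ^^ n) w" using x(2) by (rule rangeE)
      then have "w \<in> ker (A ^^ Suc n)" using x(1) by (simp add: ker_def)
      then have "w \<in> ker (A ^^ n)" using K[of "Suc n"] by simp
      then show ?thesis using w by (simp add: ker_def)
    qed
    moreover have "0 \<in> ker A" by (rule cvec.subspace_0[OF subspace_ker[OF lin]])
    moreover have "0 \<in> range (A ^^ n)" by (rule cvec.subspace_0[OF clinear_subspace_range[OF lin_n]])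
    ultimately show "ker A \<inter> range (A ^^ n) = {0}" by (intro equalityI subsetI) auto
    show "\<forall>x. \<exists>w. x - (A ^^ n) w \<in> ker (A ^^ n)"
    proof
      fix x
      have "(A ^^ n) x \<in> range (A ^^ (n + n))" unfolding R[of "n + n", OF le_add1] by (rule rangeI)
      then obtain w where "(A ^^ n) x = (A ^^ (n + n)) w" by (rule rangeE)
      then have "(A ^^ n) x = (A ^^ n) ((A ^^ n) w)" by (simp add: funpow_add)
      then have "x - (A ^^ n) w \<in> ker (A ^^ n)" by (simp add: ker_def cvec_pair.linear_diff[OF lin_n])
      then show "\<exists>w. x - (A ^^ n) w \<in> ker (A ^^ n)" by (rule exI)
    qed
  qed
qed

text \<open>A finite Neumann series in recursive form: if \<open>A x = (A - \<mu>) z\<close>, then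
  \<open>(A - \<mu>) (z - x) = \<mu> x\<close>.\<close>

lemma nilpotent_part_in_shift_range:
  assumes A: "clinear A" and \<mu>: "\<mu> \<noteq> 0"
  shows "(A ^^ n) x = 0 \<Longrightarrow> x \<in> range (op_shift A \<mu>)"
proof (induction n arbitrary: x)
  case 0
  then have "x = op_shift A \<mu> 0" by (simp add: op_shift_def cvec_pair.linear_0[OF A])
  then show ?case by (rule range_eqI)
next
  case (Suc n)
  then have "(A ^^ n) (A x) = 0" by (simp add: funpow_swap1)
  then obtain z where "A x = op_shift A \<mu> z" using Suc.IH by (auto elim: rangeE)
  then have "op_shift A \<mu> (inverse \<mu> *\<^sub>C (z - x)) = inverse \<mu> *\<^sub>C (A x - op_shift A \<mu> x)"
    by (simp add: op_shift_def cvec_pair.linear_diff[OF A] cvec_pair.linear_scale[OF A]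
        cvec.scale_right_diff_distrib scaleC_scaleC mult.commute)
  also have "\<dots> = x" using \<mu> by (simp add: op_shift_def scaleC_scaleC)
  finally show ?case by (rule range_eqI[OF sym])
qed

lemma browder_imp_eventually_invertible:
  fixes A :: "'a::complex_hilbert_space \<Rightarrow> 'a"
  assumes A: "bounded_clinear A" "browder A"
  shows "\<forall>\<^sub>F \<mu> in at 0. op_invertible (op_shift A \<mu>)"
proof -
  obtain n where n: "closed (range (A ^^ n))" "A ` range (A ^^ n) = range (A ^^ n)"
    "ker A \<inter> range (A ^^ n) = {0}" "\<forall>x. \<exists>w. x - (A ^^ n) w \<in> ker (A ^^ n)"
    by (rule browder_splitting[OF A]) (rule that)
  define M where "M = range (A ^^ n)"
  have lin: "clinear A" using bounded_clinear_imp_clinear[OF A(1)] .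
  have M: "closed M" "cvec.subspace M" "A ` M = M"
    using n unfolding M_def
    by (simp_all add: clinear_subspace_range bounded_clinear_imp_clinear bounded_clinear_funpow A(1))
  have kM: "x = 0" if "x \<in> M" "A x = 0" for x
    using n(3) that unfolding M_def ker_def by blast
  obtain C where C: "C > 0" "\<And>\<mu> y. cmod \<mu> * C \<le> 1/2 \<Longrightarrow> y \<in> M \<Longrightarrow>
    \<exists>x\<in>M. op_shift A \<mu> x = y \<and> norm x \<le> 2 * C * norm y"
    using shift_solvable_on_invariant[OF A(1) M] by blast
  obtain D where D: "D > 0" "\<forall>y\<in>A ` M. \<exists>x\<in>M. A x = y \<and> norm x \<le> D * norm y"
    using open_mapping_subspace[OF bounded_clinear_imp_bounded_linear[OF A(1)] M(1)
        cvec_subspace_imp_subspace[OF M(2)]] M by auto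
  have Dlow: "norm x \<le> D * norm (A x)" if x: "x \<in> M" for x
  proof -
    obtain x' where x': "x' \<in> M" "A x' = A x" "norm x' \<le> D * norm (A x)" using D(2) x by blast
    have "x' - x = 0"
      by (rule kM[OF cvec.subspace_diff[OF M(2) x'(1) x]]) (simp add: cvec_pair.linear_diff[OF lin] x')
    then show ?thesis using x' by simp
  qed
  \<comment> \<open>The first bound makes the shift solvable on \<open>M\<close>, and
    \<open>\<mu> \<noteq> 0\<close> makes it onto the nilpotent part. An eigenvector for
    \<open>\<mu> \<noteq> 0\<close> is in the range of every power, hence in \<open>M\<close>, where
    the bound \<open>1 / D\<close> excludes it.\<close>
  have "\<forall>\<^sub>F \<mu> in at 0. cmod \<mu> < 1 / (2 * C) \<and> cmod \<mu> < 1 / D \<and> \<mu> \<noteq> 0"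
    using C(1) D(1) by (intro eventually_conj eventually_cmod_less eventually_neq_at_within) auto
  then show ?thesis
  proof eventually_elim
    case (elim \<mu>)
    have bs: "bounded_clinear (op_shift A \<mu>)" by (rule bounded_clinear_shift[OF A(1)])
    have ls: "clinear (op_shift A \<mu>)" using bounded_clinear_imp_clinear[OF bs] .
    have "x = 0" if x: "op_shift A \<mu> x = 0" for x
    proof -
      have Ax: "A x = \<mu> *\<^sub>C x" using x by (simp add: op_shift_def)
      have pow: "(A ^^ k) x = \<mu> ^ k *\<^sub>C x" for k
        by (induction k) (simp_all add: cvec_pair.linear_scale[OF lin] Ax scaleC_scaleC mult.commute)
      have "(A ^^ n) (inverse (\<mu> ^ n) *\<^sub>C x) = inverse (\<mu> ^ n) *\<^sub>C (A ^^ n) x"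
        by (rule cvec_pair.linear_scale[OF bounded_clinear_imp_clinear[OF bounded_clinear_funpow[OF A(1)]]])
      also have "\<dots> = x" using elim by (simp add: pow scaleC_scaleC)
      finally have "x \<in> M" unfolding M_def by (rule range_eqI[OF sym])
      then have "norm x \<le> (D * cmod \<mu>) * norm x" using Dlow[of x] by (simp add: Ax norm_scaleC)
      moreover have "D * cmod \<mu> < 1" using elim D(1) by (simp add: field_simps)
      ultimately show ?thesis
        using mult_strict_right_mono[of "D * cmod \<mu>" 1 "norm x"] by (cases "x = 0") auto
    qed
    then have "ker (op_shift A \<mu>) = {0}"
      using cvec_pair.linear_0[OF ls] unfolding ker_def by blast
    moreover have "x \<in> range (op_shift A \<mu>)" for x
    proof -
      obtain w where w: "x - (A ^^ n) w \<in> ker (A ^^ n)" using spec[OF n(4), of x] by (elim exE)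
      have "x - (A ^^ n) w \<in> range (op_shift A \<mu>)"
        using nilpotent_part_in_shift_range[OF lin, of \<mu> n] w elim by (simp add: ker_def)
      moreover have "(A ^^ n) w \<in> range (op_shift A \<mu>)"
      proof -
        have "cmod \<mu> * C \<le> 1/2" using elim C(1) by (simp add: field_simps)
        moreover have "(A ^^ n) w \<in> M" by (simp add: M_def)
        ultimately have "\<exists>z\<in>M. op_shift A \<mu> z = (A ^^ n) w \<and> norm z \<le> 2 * C * norm ((A ^^ n) w)"
          by (rule C(2))
        then obtain z where "op_shift A \<mu> z = (A ^^ n) w" by blast
        then show ?thesis by (rule range_eqI[OF sym])
      qed
      ultimately have "x - (A ^^ n) w + (A ^^ n) w \<in> range (op_shift A \<mu>)"
        by (rule cvec.subspace_add[OF clinear_subspace_range[OF ls]])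
      then show ?thesis by simp
    qed
    then have "range (op_shift A \<mu>) = UNIV" by (rule UNIV_eq_I[symmetric])
    ultimately show ?case using op_invertible_iff[OF bs] by simp
  qed
qed

text \<open>If \<open>A\<close> is injective, so are its powers; the nilpotent summand vanishes and
  the other one lies in \<open>range A\<close>. If \<open>A\<close> is onto, the other summand is
  everything, and \<open>A\<close> is injective on it.\<close>

lemma browder_imp_inj_iff_surj:
  fixes A :: "'a::complex_hilbert_space \<Rightarrow> 'a"
  assumes A: "bounded_clinear A" "browder A"
  shows "ker A = {0} \<longleftrightarrow> range A = UNIV"
proof -
  have lin: "clinear A" using bounded_clinear_imp_clinear[OF A(1)] .
  obtain n where n: "closed (range (A ^^ n))" "A ` range (A ^^ n) = range (A ^^ n)"
    "ker A \<inter> range (A ^^ n) = {0}" "\<forall>x. \<exists>w. x - (A ^^ n) w \<in> ker (A ^^ n)"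
    by (rule browder_splitting[OF A]) (rule that)
  show ?thesis
  proof
    assume k: "ker A = {0}"
    have inj: "(A ^^ m) x = 0 \<Longrightarrow> x = 0" for m x
      using k by (induction m) (auto simp: ker_def)
    have "x \<in> range A" for x
    proof -
      obtain w where "x - (A ^^ n) w \<in> ker (A ^^ n)" using spec[OF n(4), of x] by (elim exE)
      then have "x = (A ^^ n) w" using inj[of n "x - (A ^^ n) w"] by (simp add: ker_def)
      then have "x \<in> A ` range (A ^^ n)" unfolding n(2) by (rule range_eqI)
      then show ?thesis by (metis imageE rangeI)
    qed
    then show "range A = UNIV" by (rule UNIV_eq_I[symmetric])
  next
    assume "range A = UNIV"
    then have "range (A ^^ m) = UNIV" for m
      by (induction m) (simp_all only: range_funpow_Suc funpow.simps(1) image_id id_apply)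
    then show "ker A = {0}" using n(3) by simp
  qed
qed

section \<open>Consistently invertible operators\<close>

lemma op_invertible_iff_bij:
  fixes A :: "'a::complex_hilbert_space \<Rightarrow> 'a"
  assumes A: "bounded_clinear A" shows "op_invertible A \<longleftrightarrow> bij A"
  unfolding op_invertible_iff[OF A] ker_def bij_def
    cvec_pair.linear_inj_iff_eq_0[OF bounded_clinear_imp_clinear[OF A]]
  using cvec_pair.linear_0[OF bounded_clinear_imp_clinear[OF A]] by auto

text \<open>A bijective \<open>A\<close> could be cancelled from both products, which would then be
  invertible exactly when \<open>S\<close> is. For other \<open>A\<close>, invertibility of
  \<open>A \<circ> S\<close> makes \<open>A\<close> onto, and that of \<open>S \<circ> A\<close>
  makes it bounded below.\<close>

lemma not_consistently_invertible_cases: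
  fixes A :: "'a::complex_hilbert_space \<Rightarrow> 'a"
  assumes A: "bounded_clinear A" "\<not> consistently_invertible A"
  shows "(range A = UNIV \<and> ker A \<noteq> {0}) \<or> (bounded_below_op A \<and> range A \<noteq> UNIV)"
proof -
  obtain S where S: "bounded_clinear S" "op_invertible (A \<circ> S) \<noteq> op_invertible (S \<circ> A)"
    using A(2) unfolding consistently_invertible_def by blast
  have AS: "bounded_clinear (A \<circ> S)" "bounded_clinear (S \<circ> A)"
    using bounded_clinear_compose[OF A(1) S(1)] bounded_clinear_compose[OF S(1) A(1)] by (simp_all add: o_def)
  have notinv: "\<not> bij A"
  proof
    assume bA: "bij A"
    have "bij (A \<circ> S) \<Longrightarrow> bij S"
    proof -
      assume "bij (A \<circ> S)"
      then have "bij (inv A \<circ> (A \<circ> S))" using bA bij_comp bij_imp_bij_inv by blast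
      moreover have "inv A \<circ> (A \<circ> S) = S" using bA by (simp add: fun_eq_iff bij_is_inj)
      ultimately show "bij S" by simp
    qed
    moreover have "bij (S \<circ> A) \<Longrightarrow> bij S"
    proof -
      assume "bij (S \<circ> A)"
      then have "bij ((S \<circ> A) \<circ> inv A)" using bA bij_comp bij_imp_bij_inv by blast
      moreover have "(S \<circ> A) \<circ> inv A = S" using bA by (simp add: fun_eq_iff bij_is_surj surj_f_inv_f)
      ultimately show "bij S" by simp
    qed
    ultimately show False using S(2) bA bij_comp unfolding AS[THEN op_invertible_iff_bij] by blast
  qed
  consider "op_invertible (A \<circ> S)" | "op_invertible (S \<circ> A)" using S(2) by blast
  then show ?thesis
  proof cases
    case 1
    then have "surj (A \<circ> S)" using op_invertible_iff_bij[OF AS(1)] by (simp add: bij_def)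
    then have "range A = UNIV" unfolding surj_def comp_apply by metis
    moreover have "ker A \<noteq> {0}" using notinv op_invertible_iff_bij[OF A(1)] op_invertible_iff[OF A(1)] \<open>range A = UNIV\<close> by simp
    ultimately show ?thesis by simp
  next
    case 2
    then obtain c where c: "c > 0" "\<And>x. c * norm x \<le> norm (S (A x))"
      using op_invertible_imp_bounded_below[OF AS(2)] unfolding bounded_below_op_def by auto
    obtain B where B: "B > 0" "\<And>x. norm (S x) \<le> norm x * B"
      using bounded_linear.pos_bounded[OF bounded_clinear_imp_bounded_linear[OF S(1)]] by blast
    have "c / B * norm x \<le> norm (A x)" for x
      using order_trans[OF c(2)[of x] B(2)[of "A x"]] B(1) by (simp add: field_simps)
    then have bb: "bounded_below_op A" unfolding bounded_below_op_def using c(1) B(1) by (intro exI[of _ "c/B"]) simp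
    then have "range A \<noteq> UNIV"
      using notinv op_invertible_iff_bij[OF A(1)] op_invertible_iff[OF A(1)] bounded_below_op_iff[OF A(1)] by simp
    then show ?thesis using bb by simp
  qed
qed

text \<open>The left inverse obtained from the orthogonal projection onto the range is the required witness.\<close>

lemma bounded_below_not_surj_imp_not_consistently_invertible:
  fixes A :: "'a::complex_hilbert_space \<Rightarrow> 'a"
  assumes A: "bounded_clinear A" "bounded_below_op A" "range A \<noteq> UNIV"
  shows "\<not> consistently_invertible A"
proof -
  have lin: "clinear A" using bounded_clinear_imp_clinear[OF A(1)] .
  obtain c where c: "c > 0" "\<And>x. c * norm x \<le> norm (A x)"
    using A unfolding bounded_below_op_def by blast
  have R: "closed (range A)" "ker A = {0}" using A bounded_below_op_iff[OF A(1)] by auto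
  have sub: "cvec.subspace (range A)" by (rule clinear_subspace_range[OF lin])
  have "\<exists>x. \<forall>z. inner (y - A x) (A z) = 0" for y
    using orthogonal_projection_exists[OF R(1) cvec_subspace_imp_subspace[OF sub], of y] by auto
  then obtain S where S: "\<And>y z. inner (y - A (S y)) (A z) = 0" by metis
  \<comment> \<open>\<open>S y\<close> is the only \<open>x\<close> with \<open>y - A x\<close>
    orthogonal to the range; linearity and \<open>S \<circ> A = id\<close> follow from this
    uniqueness.\<close>
  have uniq: "x = S y" if "\<And>z. inner (y - A x) (A z) = 0" for x y
  proof -
    have "inner (A (S y - x)) (A z) = 0" for z
      using that[of z] S[of y z] by (simp add: cvec_pair.linear_diff[OF lin] inner_diff_left)
    then have "A (S y - x) = 0" using inner_eq_zero_iff by blast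
    then have "A (S y) = A x" by (simp add: cvec_pair.linear_diff[OF lin])
    then show ?thesis using ker_inj[OF lin R(2)] by metis
  qed
  have bS: "bounded_clinear S"
  proof (rule bounded_clinearI[where C = "1/c"])
    show "S (x + y) = S x + S y" for x y
    proof (rule uniq[symmetric])
      fix z show "inner (x + y - A (S x + S y)) (A z) = 0"
        using S[of x z] S[of y z] by (simp add: cvec_pair.linear_add[OF lin] inner_diff_left inner_add_left)
    qed
    show "S (a *\<^sub>C x) = a *\<^sub>C S x" for a x
    proof (rule uniq[symmetric])
      fix z
      \<comment> \<open>Orthogonality is known only for the real inner product; as the range is a
        complex subspace, the scalar can be moved to the other argument.\<close>
      have "inner (a *\<^sub>C x - A (a *\<^sub>C S x)) (A z) = inner (a *\<^sub>C (x - A (S x))) (A z)"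
        by (simp add: cvec_pair.linear_scale[OF lin] cvec.scale_right_diff_distrib)
      also have "\<dots> = inner (x - A (S x)) (A (cnj a *\<^sub>C z))"
        by (simp add: inner_eq_Re_cinner cinner_scaleC_left cinner_scaleC_right cvec_pair.linear_scale[OF lin])
      finally show "inner (a *\<^sub>C x - A (a *\<^sub>C S x)) (A z) = 0" by (simp only: S)
    qed
    show "norm (S y) \<le> norm y * (1/c)" for y
    proof -
      have "(norm y)\<^sup>2 = (norm (A (S y)))\<^sup>2 + (norm (y - A (S y)))\<^sup>2"
        using S[of y "S y"] by (simp add: power2_norm_eq_inner inner_diff inner_commute)
      then have "(norm (A (S y)))\<^sup>2 \<le> (norm y)\<^sup>2" by simp
      then have "norm (A (S y)) \<le> norm y" by (rule power2_le_imp_le) simp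
      then show ?thesis using c(2)[of "S y"] c(1) by (simp add: field_simps)
    qed
  qed
  have "S (A x) = x" for x by (rule uniq[symmetric]) simp
  then have "S \<circ> A = id" by (simp add: fun_eq_iff)
  moreover have "bounded_clinear (id :: 'a \<Rightarrow> 'a)" using bounded_clinear_id by (simp add: id_def)
  ultimately have "op_invertible (S \<circ> A)"
    unfolding op_invertible_def by (intro exI[of _ id]) simp
  moreover have "\<not> op_invertible (A \<circ> S)"
  proof
    assume "op_invertible (A \<circ> S)"
    then have "\<exists>Q. (A \<circ> S) \<circ> Q = id" unfolding op_invertible_def by blast
    then obtain Q where "A (S (Q y)) = y" for y by (auto simp: fun_eq_iff)
    then have "surj A" by (rule surjI)
    then show False using A(3) by simp
  qed
  ultimately show ?thesis unfolding consistently_invertible_def using bS by blast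
qed

section \<open>Commuting finite rank perturbations\<close>

lemma eigenvectors_independent:
  assumes T: "clinear T" and V: "finite V" "\<And>v. v \<in> V \<Longrightarrow> v \<noteq> 0 \<and> T v = e v *\<^sub>C v" "inj_on e V"
  shows "cvec.independent V"
  using V
proof (induction V rule: finite_induct)
  case (insert w V)
  have ind: "cvec.independent V" using insert by simp
  have "w \<notin> cvec.span V"
  proof
    assume "w \<in> cvec.span V"
    then obtain u where u: "w = (\<Sum>v\<in>V. u v *\<^sub>C v)"
      using cvec.span_finite[OF insert.hyps(1)] by auto
    \<comment> \<open>Applying \<open>T - e w\<close> to the expansion of \<open>w\<close> kills the
      left side and multiplies each coefficient by the nonzero \<open>e v - e w\<close>.\<close>
    have "(\<Sum>v\<in>V. (u v * (e v - e w)) *\<^sub>C v) = (\<Sum>v\<in>V. u v *\<^sub>C (e v *\<^sub>C v)) - e w *\<^sub>C w"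
      unfolding u cvec.scale_sum_right sum_subtractf[symmetric]
      by (intro sum.cong refl) (simp add: scaleC_scaleC cvec.scale_left_diff_distrib algebra_simps)
    also have "(\<Sum>v\<in>V. u v *\<^sub>C (e v *\<^sub>C v)) = T w"
      unfolding u cvec_pair.linear_sum[OF T] using insert.prems(1)
      by (intro sum.cong refl) (simp add: cvec_pair.linear_scale[OF T])
    also have "T w - e w *\<^sub>C w = 0" using insert.prems(1)[of w] by simp
    finally have z: "(\<Sum>v\<in>V. (u v * (e v - e w)) *\<^sub>C v) = 0" .
    have "u v = 0" if "v \<in> V" for v
    proof -
      have "u v * (e v - e w) = 0" using cvec.independentD[OF ind insert.hyps(1) subset_refl z that] .
      moreover have "e v \<noteq> e w" using insert.prems(2) insert.hyps(2) that by (auto simp: inj_on_def)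
      ultimately show ?thesis by simp
    qed
    then have "w = 0" using u by simp
    then show False using insert.prems(1) by simp
  qed
  then show ?case using ind by (rule cvec.independent_insertI)
qed (rule cvec.independent_empty)

lemma finite_eigenvalues_on_findim:
  assumes T: "clinear T" and W: "findim W"
  shows "finite {\<mu>. \<exists>x\<in>W. x \<noteq> 0 \<and> T x = \<mu> *\<^sub>C x}"
proof (rule ccontr)
  assume "\<not> ?thesis"
  then obtain S where S: "S \<subseteq> {\<mu>. \<exists>x\<in>W. x \<noteq> 0 \<and> T x = \<mu> *\<^sub>C x}" "card S = Suc (cvec.dim W)" "finite S"
    using infinite_arbitrarily_large by blast
  have "\<forall>\<mu>\<in>S. \<exists>x. x \<in> W \<and> x \<noteq> 0 \<and> T x = \<mu> *\<^sub>C x" using S(1) by blast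
  then obtain x where x: "\<And>\<mu>. \<mu> \<in> S \<Longrightarrow> x \<mu> \<in> W \<and> x \<mu> \<noteq> 0 \<and> T (x \<mu>) = \<mu> *\<^sub>C x \<mu>" by metis
  have inj: "inj_on x S"
  proof (rule inj_onI)
    fix \<mu> \<nu> assume "\<mu> \<in> S" "\<nu> \<in> S" "x \<mu> = x \<nu>"
    then have "\<mu> *\<^sub>C x \<mu> = \<nu> *\<^sub>C x \<mu>" "x \<mu> \<noteq> 0" using x by metis+
    then show "\<mu> = \<nu>" by simp
  qed
  have "cvec.independent (x ` S)"
  proof (rule eigenvectors_independent[OF T, where e = "inv_into S x"])
    show "inj_on (inv_into S x) (x ` S)" by (rule inj_on_inv_into) simp
    show "v \<noteq> 0 \<and> T v = inv_into S x v *\<^sub>C v" if "v \<in> x ` S" for v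
    proof -
      obtain \<mu> where \<mu>: "\<mu> \<in> S" "v = x \<mu>" using \<open>v \<in> x ` S\<close> by (rule imageE)
      then show ?thesis using x[OF \<mu>(1)] inv_into_f_f[OF inj \<mu>(1)] by simp
    qed
  qed (use S(3) in simp)
  moreover have "x ` S \<subseteq> W" using x by blast
  ultimately have "card (x ` S) \<le> cvec.dim W" using findim_independent_bound(2)[OF W] by blast
  then show False using card_image[OF inj] S(2) by simp
qed

text \<open>An invertible \<open>C = T + K - \<mu>\<close> commutes with \<open>K\<close> and so
  maps the finite-dimensional range of \<open>K\<close> onto itself. A vector \<open>x\<close> in
  the kernel of \<open>T - \<mu>\<close> has \<open>C x = K x\<close>, so it lies in that range.
  Only finitely many eigenvalues have eigenvectors there, and points near \<open>l\<close> other
  than \<open>l\<close> avoid them; then \<open>T - \<mu> = C - K\<close> is injective, hence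
  onto.\<close>

lemma eventually_invertible_finite_rank_perturbation:
  fixes T K :: "'a::complex_hilbert_space \<Rightarrow> 'a"
  assumes T: "bounded_clinear T" and K: "bounded_clinear K" "finite_rank K"
    and comm: "\<And>x. K (T x) = T (K x)"
    and ev: "\<forall>\<^sub>F \<mu> in at l. op_invertible (op_shift (\<lambda>x. T x + K x) \<mu>)"
  shows "\<forall>\<^sub>F \<mu> in at l. op_invertible (op_shift T \<mu>)"
proof -
  have linT: "clinear T" and linK: "clinear K" using T K bounded_clinear_imp_clinear by auto
  define W where "W = range K"
  have W: "findim W" "cvec.subspace W"
    using K(2) clinear_subspace_range[OF linK] by (simp_all add: W_def finite_rank_iff)
  define X where "X = {\<mu>. \<exists>x\<in>W. x \<noteq> 0 \<and> T x = \<mu> *\<^sub>C x}"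
  have "finite X" unfolding X_def by (rule finite_eigenvalues_on_findim[OF linT W(1)])
  then have "\<forall>\<^sub>F \<mu> in at l. \<mu> \<notin> X" using islimpt_finite islimpt_iff_eventually by blast
  with ev show ?thesis
  proof eventually_elim
    case (elim \<mu>)
    define C where "C = op_shift (\<lambda>x. T x + K x) \<mu>"
    have C: "bounded_clinear C" "op_invertible C"
      unfolding C_def using bounded_clinear_shift[OF bounded_clinear_add[OF T K(1)]] elim by auto
    have linC: "clinear C" using bounded_clinear_imp_clinear[OF C(1)] .
    have kC: "ker C = {0}" using C op_invertible_iff[OF C(1)] by simp
    have bS: "bounded_clinear (op_shift T \<mu>)" by (rule bounded_clinear_shift[OF T])
    have CK: "C (K x) = K (C x)" for x
      by (simp add: C_def op_shift_def comm cvec_pair.linear_diff[OF linK] cvec_pair.linear_add[OF linK]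
          cvec_pair.linear_scale[OF linK])
    have CW: "C ` W = W"
    proof (rule findim_inj_imp_surj[OF linC W])
      show "x = 0" if "C x = 0" for x
        using ker_inj[OF linC kC, of x 0] that cvec_pair.linear_0[OF linC] by simp
      show "C ` W \<subseteq> W" unfolding W_def by (auto simp: CK)
    qed
    have "x = 0" if x: "op_shift T \<mu> x = 0" for x
    proof -
      have "C x = op_shift T \<mu> x + K x" by (simp add: C_def op_shift_def)
      then have "C x = K x" by (simp add: x)
      then have "C x \<in> C ` W" unfolding CW by (simp add: W_def)
      then have "x \<in> W" using ker_inj[OF linC kC] by (metis imageE)
      moreover have "T x = \<mu> *\<^sub>C x" using x by (simp add: op_shift_def)
      ultimately show ?thesis using elim(2) unfolding X_def by blast
    qed
    then have ker: "ker (op_shift T \<mu>) = {0}"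
      using cvec_pair.linear_0[OF bounded_clinear_imp_clinear[OF bS]] unfolding ker_def by blast
    have eq: "op_shift T \<mu> = (\<lambda>x. C x + - K x)" by (auto simp: C_def op_shift_def)
    have "range (op_shift T \<mu>) = UNIV"
      unfolding eq
      by (rule invertible_plus_finite_rank_surj[OF C(2,1) bounded_clinear_imp_clinear[OF bounded_clinear_minus[OF K(1)]]
            finite_rank_minus[OF K(2)]]) (use ker eq in simp)
    then show ?case using ker op_invertible_iff[OF bS] by simp
  qed
qed

section \<open>Property \<open>(UW\<^sub>E)\<close>\<close>

lemma cdim_pos_iff:
  assumes S: "cvec.subspace S" shows "cdim S > 0 \<longleftrightarrow> S \<noteq> {0}"
proof (cases "findim S")
  case True
  obtain B where B: "finite B" "cvec.independent B" "B \<subseteq> S" "cvec.span B = S" "card B = cvec.dim S"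
    using findim_basis[OF True S] by metis
  have "S = {0} \<longleftrightarrow> B = {}"
  proof
    assume "S = {0}"
    then have "B \<subseteq> {0}" using B(3) by simp
    moreover have "0 \<notin> B" using B(2) cvec.dependent_zero by blast
    ultimately show "B = {}" by blast
  next
    assume "B = {}"
    then show "S = {0}" using B(4) by simp
  qed
  then show ?thesis using B(1,5) by (simp add: cdim_findim[OF True] card_gt_0_iff zero_enat_def flip: B(5))
next
  case False
  then have "cdim S = \<infinity>" using cdim_less_infinity_iff[of S] by (cases "cdim S") auto
  moreover have "findim {0::'a}" using findim_span[of "{}"] by simp
  ultimately show ?thesis using False by auto
qed

lemma mem_iso_spectrum_iff:
  "l \<in> iso_spectrum T \<longleftrightarrow>
    \<not> op_invertible (op_shift T l) \<and> (\<forall>\<^sub>F \<mu> in at l. op_invertible (op_shift T \<mu>))"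
  by (simp add: iso_spectrum_def isolated_in_altdef spectrum_def)

lemma isoloid_iff:
  fixes T :: "'a::complex_hilbert_space \<Rightarrow> 'a"
  assumes T: "bounded_clinear T"
  shows "isoloid T \<longleftrightarrow> (\<forall>l. \<not> op_invertible (op_shift T l) \<longrightarrow>
    (\<forall>\<^sub>F \<mu> in at l. op_invertible (op_shift T \<mu>)) \<longrightarrow> ker (op_shift T l) \<noteq> {0})"
proof -
  have "is_eigenvalue T l \<longleftrightarrow> ker (op_shift T l) \<noteq> {0}" for l
  proof -
    have "op_shift T l 0 = 0"
      using cvec_pair.linear_0[OF bounded_clinear_imp_clinear[OF bounded_clinear_shift[OF T]]] .
    then have "ker (op_shift T l) \<noteq> {0} \<longleftrightarrow> (\<exists>x. x \<noteq> 0 \<and> op_shift T l x = 0)" unfolding ker_def by blast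
    then show ?thesis by (simp add: is_eigenvalue_def op_shift_def)
  qed
  then show ?thesis unfolding isoloid_def by (auto simp: mem_iso_spectrum_iff)
qed

text \<open>Bounded below points belong to neither side of the defining equality, since there the
  shift is upper semi-Weyl. Elsewhere a nonzero kernel already puts \<open>l\<close> in the
  spectrum, so isolation is a matter of the punctured neighbourhood only.\<close>

lemma property_UWE_iff:
  fixes T :: "'a::complex_hilbert_space \<Rightarrow> 'a"
  assumes T: "bounded_clinear T"
  shows "property_UWE T \<longleftrightarrow> (\<forall>l. \<not> bounded_below_op (op_shift T l) \<longrightarrow>
    (upper_semi_weyl (op_shift T l) \<longleftrightarrow>
      (\<forall>\<^sub>F \<mu> in at l. op_invertible (op_shift T \<mu>)) \<and> ker (op_shift T l) \<noteq> {0}))"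
proof -
  have b: "bounded_clinear (op_shift T l)" for l by (rule bounded_clinear_shift[OF T])
  have E: "l \<in> iso_eigenvalues T \<longleftrightarrow>
    (\<forall>\<^sub>F \<mu> in at l. op_invertible (op_shift T \<mu>)) \<and> ker (op_shift T l) \<noteq> {0}" for l
    using cdim_pos_iff[OF subspace_ker[OF bounded_clinear_imp_clinear[OF b]], of l] op_invertible_iff[OF b, of l]
    by (auto simp: iso_eigenvalues_def mem_iso_spectrum_iff nullity_def)
  show ?thesis
    unfolding property_UWE_def set_eq_iff Diff_iff E
    using bounded_below_imp_upper_semi_weyl[OF b]
    by (auto simp: approx_spectrum_def upper_semi_weyl_spectrum_def)
qed

text \<open>The term \<open>n = 0\<close> of \<open>hyperrange\<close> is the whole space, which
  reconciles it with the intersection over \<open>n \<ge> 1\<close>.\<close>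

lemma mem_vv_resolvent_iff:
  "l \<in> vv_resolvent T \<longleftrightarrow> (\<forall>\<^sub>F \<mu> in at l. upper_semi_weyl (op_shift T \<mu>) \<and>
    ker (op_shift T \<mu>) \<subseteq> hyperrange (op_shift T \<mu>))"
proof -
  have "hyperrange A = (\<Inter>n\<in>{1..}. range (A ^^ n))" for A :: "'a \<Rightarrow> 'a"
  proof
    show "(\<Inter>n\<in>{1..}. range (A ^^ n)) \<subseteq> hyperrange A"
    proof
      fix x assume x: "x \<in> (\<Inter>n\<in>{1..}. range (A ^^ n))"
      have "x \<in> range (A ^^ n)" for n
        using x by (cases n) (auto simp del: funpow.simps(2))
      then show "x \<in> hyperrange A" by (simp add: hyperrange_def)
    qed
  qed (auto simp: hyperrange_def)
  then show ?thesis
    unfolding vv_resolvent_def eventually_at by (simp add: dist_norm norm_minus_commute eq_commute[of l])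
qed

lemma bounded_below_iff_upper_semi_weyl_inj:
  fixes A :: "'a::complex_hilbert_space \<Rightarrow> 'a"
  assumes A: "bounded_clinear A"
  shows "bounded_below_op A \<longleftrightarrow> upper_semi_weyl A \<and> ker A = {0}"
  using bounded_below_imp_upper_semi_weyl[OF A] bounded_below_op_iff[OF A] upper_semi_weyl_alt[of A] by metis

lemma not_in_closure_CI_spectrum_iff:
  "l \<notin> closure (CI_spectrum T) \<longleftrightarrow>
    consistently_invertible (op_shift T l) \<and> (\<forall>\<^sub>F \<mu> in at l. consistently_invertible (op_shift T \<mu>))"
  by (simp add: closure_def islimpt_iff_eventually CI_spectrum_def)

theorem theorem2p2:
  fixes T K :: "'a::complex_hilbert_space \<Rightarrow> 'a"
  assumes "separable_space (euclidean :: 'a topology)"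
    and "cdim (UNIV :: 'a set) = \<infinity>"
    and "bounded_clinear T" and "property_UWE T"
    and "bounded_clinear K" and "finite_rank K"
    and "K \<circ> T = T \<circ> K"
  shows "((isoloid (\<lambda>x. T x + K x) \<and> property_UWE (\<lambda>x. T x + K x)) \<longleftrightarrow>
      (isoloid T \<and> property_UWE (\<lambda>x. T x + K x))) \<and>
    ((isoloid T \<and> property_UWE (\<lambda>x. T x + K x)) \<longleftrightarrow>
      (browder_spectrum T \<inter> approx_spectrum (\<lambda>x. T x + K x) =
        vv_spectrum T \<union> (closure (CI_spectrum T) \<inter> approx_spectrum T)))"
proof -
  note T = assms(3) and K = assms(5,6)
  define U where "U = (\<lambda>x. T x + K x)"
  have comm: "K (T x) = T (K x)" for x using assms(7) by (metis comp_apply)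
  have U: "bounded_clinear U" unfolding U_def by (rule bounded_clinear_add[OF T K(1)])
  have mK: "bounded_clinear (\<lambda>x. - K x)" "finite_rank (\<lambda>x. - K x)"
    using bounded_clinear_minus[OF K(1)] finite_rank_minus[OF K(2)] .
  have TU: "T = (\<lambda>x. U x + - K x)" by (simp add: U_def)
  \<comment> \<open>This lets \<open>T\<close> and \<open>U\<close> exchange roles: \<open>T\<close>
    is the perturbation of \<open>U\<close> by \<open>- K\<close>.\<close>
  have commU: "- K (U x) = U (- K x)" for x
    using cvec_pair.linear_add[OF bounded_clinear_imp_clinear[OF K(1)], of "T x" "K x"]
      cvec_pair.linear_neg[OF bounded_clinear_imp_clinear[OF T], of "K x"]
      cvec_pair.linear_neg[OF bounded_clinear_imp_clinear[OF K(1)], of "K x"]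
    by (simp add: U_def comm)
  have sT: "bounded_clinear (op_shift T l)" and sU: "bounded_clinear (op_shift U l)" for l
    by (rule bounded_clinear_shift[OF T] bounded_clinear_shift[OF U])+

  let ?inv = "\<lambda>A l. op_invertible (op_shift A l)"
  let ?iso = "\<lambda>A l. \<forall>\<^sub>F \<mu> in at l. op_invertible (op_shift A \<mu>)"
  let ?bb = "\<lambda>A l. bounded_below_op (op_shift A l)"
  let ?usw = "\<lambda>A l. upper_semi_weyl (op_shift A l)"
  let ?br = "\<lambda>l. browder (op_shift T l)"
  let ?ci = "\<lambda>l. consistently_invertible (op_shift T l)"

  define srj where "srj l \<longleftrightarrow> range (op_shift T l) = UNIV" for l
  define inj where "inj A l \<longleftrightarrow> ker (op_shift A l) = {0}" for A :: "'a \<Rightarrow> 'a" and l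

  \<comment> \<open>Properties shared by \<open>T\<close> and \<open>T + K\<close>\<close>
  have iso_eq: "?iso T l \<longleftrightarrow> ?iso U l" for l
  proof
    assume "?iso T l"
    then show "?iso U l"
      using eventually_invertible_finite_rank_perturbation[OF U mK commU] TU by simp
  qed (use eventually_invertible_finite_rank_perturbation[OF T K comm] in \<open>simp add: U_def\<close>)
  have usw_eq: "?usw T l \<longleftrightarrow> ?usw U l" for l
  proof -
    have "op_shift U l = (\<lambda>x. op_shift T l x + K x)" "op_shift T l = (\<lambda>x. op_shift U l x + - K x)"
      by (auto simp: op_shift_def U_def)
    then show ?thesis
      using upper_semi_weyl_finite_rank_perturbation[OF sT _ K] upper_semi_weyl_finite_rank_perturbation[OF sU _ mK]
      by metis
  qed

  \<comment> \<open>Implications between the conditions at a single point\<close>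
  have inv_bb: "?inv T l \<Longrightarrow> ?bb T l" for l by (rule op_invertible_imp_bounded_below[OF sT])
  have bb_T: "?bb T l \<longleftrightarrow> ?usw T l \<and> inj T l" and bb_U: "?bb U l \<longleftrightarrow> ?usw U l \<and> inj U l" for l
    unfolding inj_def by (rule bounded_below_iff_upper_semi_weyl_inj[OF sT] bounded_below_iff_upper_semi_weyl_inj[OF sU])+
  note iso_0 = eventually_at_shift[of "op_invertible"]
  have iso_bb_T: "?iso T l \<Longrightarrow> ?bb T l \<Longrightarrow> ?inv T l" and iso_bb_U: "?iso U l \<Longrightarrow> ?bb U l \<Longrightarrow> ?inv U l" for l
    using bounded_below_limit_of_invertible[OF sT _ iso_0[THEN iffD1]]
      bounded_below_limit_of_invertible[OF sU _ iso_0[THEN iffD1]] by blast+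
  have iso_usw_br: "?iso T l \<Longrightarrow> ?usw T l \<Longrightarrow> ?br l" for l
    using isolated_upper_semi_weyl_imp_browder[OF sT _ iso_0[THEN iffD1]] by blast
  have br_iso: "?br l \<Longrightarrow> ?iso T l" for l
    using iso_0[THEN iffD2, OF browder_imp_eventually_invertible[OF sT]] .
  have inv_T: "?inv T l \<longleftrightarrow> inj T l \<and> srj l" for l
    unfolding inj_def srj_def by (rule op_invertible_iff[OF sT])
  have br_inj: "?br l \<Longrightarrow> inj T l \<longleftrightarrow> srj l" for l
    unfolding inj_def srj_def by (rule browder_imp_inj_iff_surj[OF sT])
  have not_ci: "\<not> ?ci l \<Longrightarrow> (srj l \<and> \<not> inj T l) \<or> (?bb T l \<and> \<not> srj l)" for l
    unfolding inj_def srj_def by (rule not_consistently_invertible_cases[OF sT])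
  have bb_ci_inv: "?bb T l \<Longrightarrow> ?ci l \<Longrightarrow> ?inv T l" for l
    using bounded_below_not_surj_imp_not_consistently_invertible[OF sT] bb_T inv_T
    unfolding srj_def by metis
  have inv_ci: "?inv T l \<Longrightarrow> ?ci l" for l using not_ci inv_T by blast

  have UWE_T: "\<not> ?bb T l \<Longrightarrow> ?usw T l \<longleftrightarrow> ?iso T l \<and> \<not> inj T l" for l
    using assms(4) unfolding property_UWE_iff[OF T] inj_def by simp
  have UWE_U: "property_UWE U \<longleftrightarrow> (\<forall>l. \<not> ?bb U l \<longrightarrow> (?usw U l \<longleftrightarrow> ?iso U l \<and> \<not> inj U l))"
    unfolding inj_def by (rule property_UWE_iff[OF U])
  have isoloid_T: "isoloid T \<longleftrightarrow> (\<forall>l. \<not> ?inv T l \<longrightarrow> ?iso T l \<longrightarrow> \<not> inj T l)"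
    unfolding inj_def by (rule isoloid_iff[OF T])
  have isoloid_U: "isoloid U \<longleftrightarrow> (\<forall>l. \<not> ?inv U l \<longrightarrow> ?iso U l \<longrightarrow> \<not> inj U l)"
    unfolding inj_def by (rule isoloid_iff[OF U])

  \<comment> \<open>The vv-resolvent and the closure of the CI spectrum\<close>
  have ker_sub: "inj T l \<Longrightarrow> ker (op_shift T l) \<subseteq> hyperrange (op_shift T l)" for l
  proof -
    have "0 \<in> range (op_shift T l ^^ n)" for n
      by (rule cvec.subspace_0[OF clinear_subspace_range[OF bounded_clinear_imp_clinear[OF bounded_clinear_funpow[OF sT]]]])
    then show "inj T l \<Longrightarrow> ker (op_shift T l) \<subseteq> hyperrange (op_shift T l)"
      by (simp add: hyperrange_def inj_def)
  qed
  have vvI: "l \<in> vv_resolvent T" if "\<forall>\<^sub>F \<mu> in at l. ?bb T \<mu>" for l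
    unfolding mem_vv_resolvent_iff using that by eventually_elim (use bb_T ker_sub in blast)
  have bb_vv: "?bb T l \<Longrightarrow> l \<in> vv_resolvent T" for l
    using vvI[OF eventually_at_shift[THEN iffD2, OF bounded_below_shift_near_0]] .
  have iso_vv: "?iso T l \<Longrightarrow> l \<in> vv_resolvent T" for l
    by (rule vvI) (auto elim!: eventually_mono intro: inv_bb)
  \<comment> \<open>Here \<open>(UW_E)\<close> enters: an upper semi-Weyl \<open>\<mu>\<close> that
    is not bounded below would be isolated with nonzero kernel. Isolation makes this kernel meet the
    hyperrange only in 0, against the inclusion required in the vv-resolvent.\<close>
  have vv_bb: "\<forall>\<^sub>F \<mu> in at l. ?bb T \<mu>" if "l \<in> vv_resolvent T" for l
    using that unfolding mem_vv_resolvent_iff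
  proof eventually_elim
    case (elim \<mu>)
    show ?case
    proof (rule ccontr)
      assume nb: "\<not> ?bb T \<mu>"
      then have iso: "?iso T \<mu>" and ninj: "\<not> inj T \<mu>" using UWE_T elim by blast+
      have "\<forall>\<^sub>F \<nu> in at 0. op_invertible (op_shift (op_shift T \<mu>) \<nu>)"
        using iso by (rule iso_0[THEN iffD1])
      then have "\<forall>\<^sub>F \<nu> in at 0. ker (op_shift (op_shift T \<mu>) \<nu>) = {0}"
        by eventually_elim (simp add: op_invertible_iff[OF bounded_clinear_shift[OF sT]])
      moreover have "closed (range (op_shift T \<mu>))" "findim (ker (op_shift T \<mu>))"
        using elim upper_semi_weyl_alt by auto
      ultimately have "ker (op_shift T \<mu>) \<inter> hyperrange (op_shift T \<mu>) = {0}"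
        by (intro ker_Int_hyperrange_trivial[OF sT])
      then show False using ninj elim by (simp add: inj_def Int_absorb2)
    qed
  qed
  have cl: "l \<notin> closure (CI_spectrum T) \<longleftrightarrow> ?ci l \<and> (\<forall>\<^sub>F \<mu> in at l. ?ci \<mu>)" for l
    by (rule not_in_closure_CI_spectrum_iff)
  have iso_cl: "?iso T l \<Longrightarrow> ?ci l \<Longrightarrow> l \<notin> closure (CI_spectrum T)" for l
    unfolding cl by (auto elim!: eventually_mono intro: inv_ci)
  \<comment> \<open>Injectivity and surjectivity coincide for a Browder operator, which excludes
    both ways of failing to be consistently invertible.\<close>
  have br_cl: "?br l \<Longrightarrow> l \<notin> closure (CI_spectrum T)" for l
    using iso_cl br_iso not_ci br_inj bb_T by blast
  have vv_cl_iso: "?iso T l" if "l \<in> vv_resolvent T" "l \<notin> closure (CI_spectrum T)" for l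
  proof -
    have "\<forall>\<^sub>F \<mu> in at l. ?ci \<mu>" using that cl by blast
    with vv_bb[OF that(1)] show ?thesis by eventually_elim (rule bb_ci_inv)
  qed

  \<comment> \<open>Equivalence of (i) and (ii)\<close>
  have step1: "isoloid U \<longleftrightarrow> isoloid T" if P: "property_UWE U"
  proof -
    have "\<not> inj U l" if "isoloid T" "\<not> ?inv U l" "?iso U l" for l
    proof
      assume inj: "inj U l"
      have iso: "?iso T l" using that(3) iso_eq by blast
      \<comment> \<open>Either \<open>T - l\<close> is bounded below, or it is not invertible,
        \<open>l\<close> is an eigenvalue and \<open>(UW_E)\<close> applies. \<open>U - l\<close>
        inherits this; being injective it would be bounded below, and invertible as a limit of
        invertible operators.\<close>
      have "?usw T l"
        using UWE_T[of l] iso that(1) bb_T[of l] inv_bb[of l] unfolding isoloid_T by blast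
      then have "?bb U l" using usw_eq bb_U inj by blast
      then show False using iso_bb_U that by blast
    qed
    moreover have "\<not> inj T l" if "isoloid U" "\<not> ?inv T l" "?iso T l" for l
    proof
      assume inj: "inj T l"
      have iso: "?iso U l" using that(3) iso_eq by blast
      have invU: "?inv U l \<Longrightarrow> ?bb U l" by (rule op_invertible_imp_bounded_below[OF sU])
      have "?usw U l"
        using P iso that(1) bb_U[of l] invU unfolding isoloid_U UWE_U by blast
      then have "?bb T l" using usw_eq bb_T inj by blast
      then show False using iso_bb_T that by blast
    qed
    ultimately show ?thesis unfolding isoloid_T isoloid_U by blast
  qed

  \<comment> \<open>Equivalence of (ii) and (iii)\<close>
  let ?L = "\<lambda>l. \<not> ?br l \<and> \<not> ?bb U l"
  let ?R = "\<lambda>l. l \<notin> vv_resolvent T \<or> (l \<in> closure (CI_spectrum T) \<and> \<not> ?bb T l)"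
  have iii: "browder_spectrum T \<inter> approx_spectrum U = vv_spectrum T \<union> (closure (CI_spectrum T) \<inter> approx_spectrum T)
      \<longleftrightarrow> (\<forall>l. ?L l \<longleftrightarrow> ?R l)"
    unfolding set_eq_iff browder_spectrum_def approx_spectrum_def vv_spectrum_def by simp

  \<comment> \<open>This inclusion follows from \<open>(UW_E)\<close> for \<open>T\<close> alone.
    Browder points lie outside the right side; and if \<open>U - l\<close> is bounded below, then
    \<open>T - l\<close> is upper semi-Weyl, hence bounded below or Browder.\<close>
  have R_L: "?L l" if R: "?R l" for l
  proof (rule ccontr)
    assume nL: "\<not> ?L l"
    have nbr: "\<not> ?br l" using R iso_vv br_iso br_cl by blast
    then have "?usw T l" using nL bb_U usw_eq by blast
    then have "?bb T l" using UWE_T iso_usw_br nbr by blast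
    then show False using R bb_vv by blast
  qed
  \<comment> \<open>A point outside the right side has invertible neighbours: by
    \<open>(UW_E)\<close> for \<open>U\<close> if \<open>T - l\<close> is bounded below, by
    consistent invertibility otherwise. The isoloid property then makes \<open>T - l\<close> upper
    semi-Weyl and so Browder.\<close>
  have L_R: "?R l" if ii: "isoloid T" "property_UWE U" and L: "?L l" for l
  proof (rule ccontr)
    assume nR: "\<not> ?R l"
    have "?iso T l"
    proof (cases "?bb T l")
      case True
      then have "?iso U l" using ii(2) L bb_T usw_eq unfolding UWE_U by blast
      then show ?thesis using iso_eq by blast
    next
      case False
      then show ?thesis using nR vv_cl_iso by blast
    qed
    moreover from this have "?usw T l"
      using UWE_T[of l] ii(1) bb_T[of l] inv_bb[of l] unfolding isoloid_T by blast
    ultimately show False using iso_usw_br L by blast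
  qed
  \<comment> \<open>A noninvertible isolated \<open>l\<close> with injective shift is not bounded
    below, hence consistently invertible and outside the right side. It is not Browder, so (iii)
    forces \<open>U - l\<close> to be bounded below; then \<open>T - l\<close> is upper semi-Weyl
    and injective, that is, bounded below after all.\<close>
  have iii_isoloid: "isoloid T" if LR: "\<forall>l. ?L l \<longleftrightarrow> ?R l"
    unfolding isoloid_T
  proof (intro allI impI notI)
    fix l assume ninv: "\<not> ?inv T l" and iso: "?iso T l" and inj: "inj T l"
    have nbb: "\<not> ?bb T l" using iso_bb_T iso ninv by blast
    have "?ci l" using not_ci[of l] inj nbb by blast
    then have "\<not> ?R l" using iso_vv iso_cl iso by blast
    then have "\<not> ?L l" using LR by blast
    moreover have "\<not> ?br l" using br_inj inj inv_T ninv by blast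
    ultimately have "?usw T l" using bb_U usw_eq by blast
    then show False using bb_T inj nbb by blast
  qed
  have iii_UWE: "property_UWE U" if LR: "\<forall>l. ?L l \<longleftrightarrow> ?R l"
    unfolding UWE_U
  proof (intro allI impI)
    fix l assume nbb: "\<not> ?bb U l"
    show "?usw U l \<longleftrightarrow> ?iso U l \<and> \<not> inj U l"
    proof
      assume usw: "?usw U l"
      have "?iso T l"
      proof (cases "?bb T l")
        \<comment> \<open>Here \<open>(UW_E)\<close> for \<open>T\<close> says nothing; it is (iii)
          that makes \<open>l\<close> a Browder point and hence isolated.\<close>
        case True
        then have "\<not> ?R l" using bb_vv by blast
        then have "?br l" using LR nbb by blast
        then show ?thesis by (rule br_iso)
      next
        case False
        then show ?thesis using UWE_T usw usw_eq by blast
      qed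
      then show "?iso U l \<and> \<not> inj U l" using iso_eq usw nbb bb_U by blast
    next
      assume "?iso U l \<and> \<not> inj U l"
      then have iso: "?iso T l" using iso_eq by blast
      have "?usw T l"
        using UWE_T[of l] iso iii_isoloid[OF LR] bb_T[of l] inv_bb[of l] unfolding isoloid_T by blast
      then show "?usw U l" using usw_eq by blast
    qed
  qed
  have "(isoloid U \<and> property_UWE U \<longleftrightarrow> isoloid T \<and> property_UWE U) \<and>
    (isoloid T \<and> property_UWE U \<longleftrightarrow> (\<forall>l. ?L l \<longleftrightarrow> ?R l))"
    using step1 R_L L_R iii_isoloid iii_UWE by blast
  then show ?thesis unfolding iii[symmetric] unfolding U_def .
qed

end
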